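(* Let $d\ge 1$ be an integer and let $\mathcal{E}=\{E_L\}_{L\ge 1}$ be a sequence of measurable subsets of $\mathbb{S}^d$ that is relatively dense. Then $\mathcal{E}$ is $L^\infty$-Logvinenko-Sereda, i.e. there is a constant $C>0$, independent of $L$, such that for every $L\ge 1$ and every $Q_L\in\Pi_L$, $$\sup_{u\in\mathbb{S}^d}|Q_L(u)|\le C\sup_{u\in E_L}|Q_L(u)|.$$
   Context: $\mathbb{S}^d$ is the unit sphere of $\mathbb{R}^{d+1}$ with surface measure $\sigma$ and geodesic distance $d(u,v)=\arccos\langle u,v\rangle$; $B(u,\delta)=\{v\in\mathbb{S}^d: d(u,v)<\delta\}$. $\Pi_L$ is the space of (complex-valued) spherical harmonics of degree at most $L$, equivalently the space of restrictions to $\mathbb{S}^d$ of polynomials in $d+1$ variables of degree at most $L$. $\mathcal{E}$ is relatively dense if there exist $r>0$ and $\varrho>0$ such that for all $L\ge 1$, $$\inf_{u\in\mathbb{S}^d}\frac{\sigma(E_L\cap B(u,r/L))}{\sigma(B(u,r/L))}\ge\varrho.$$ *)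

theory Defs
  imports "HOL-Analysis.Analysis"
begin

text \<open>
  The sphere \<open>S\<^sup>d\<close> is \<^term>\<open>sphere (0 :: real ^ 'n) 1\<close> with \<open>CARD('n) = d + 1\<close>.

  Surface measure is obtained from Lebesgue measure in \<open>\<real>\<^sup>d\<^sup>+\<^sup>1\<close> through polar coordinates:
  \<open>\<sigma>(A) = (d + 1) * vol {t * u | 0 < t < 1, u \<in> A}\<close> (see \<open>emeasure_surface_measure\<close> below). The
  completion makes the measurable sets the \<open>\<sigma>\<close>-measurable ones and not just the Borel ones.
\<close>

definition surface_measure :: "(real ^ 'n) measure" where
  "surface_measure = completion (scale_measure (of_nat CARD('n))
     (distr (restrict_space lborel (ball 0 1 - {0})) (restrict_space borel (sphere 0 1)) sgn))"

definition geodesic_dist :: "real ^ 'n \<Rightarrow> real ^ 'n \<Rightarrow> real" where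
  "geodesic_dist u v = arccos (u \<bullet> v)"

definition geodesic_ball :: "real ^ 'n \<Rightarrow> real \<Rightarrow> (real ^ 'n) set" where
  "geodesic_ball u \<delta> = {v \<in> sphere 0 1. geodesic_dist u v < \<delta>}"

text \<open>
  The space \<open>\<Pi>\<^sub>L\<close>: restrictions to the sphere of complex polynomials of degree at most \<open>L\<close>.
  The exponent \<open>m\<close> stands for the monomial \<open>\<Prod>i. x\<^sub>i ^ m i\<close> and \<open>c m\<close> is its coefficient.
  A function on the sphere is represented by any function on the ambient space with these values
  on the sphere; its values elsewhere are irrelevant.
\<close>

definition spherical_polys :: "nat \<Rightarrow> (real ^ 'n \<Rightarrow> complex) set" where
  "spherical_polys L = {Q. \<exists>c :: ('n \<Rightarrow> nat) \<Rightarrow> complex. \<forall>u\<in>sphere 0 1.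
     Q u = (\<Sum>m | (\<Sum>i\<in>UNIV. m i) \<le> L. c m * (\<Prod>i\<in>UNIV. complex_of_real (u $ i) ^ m i))}"

definition relatively_dense :: "(nat \<Rightarrow> (real ^ 'n) set) \<Rightarrow> bool" where
  "relatively_dense E \<longleftrightarrow> (\<exists>r>0. \<exists>\<rho>>0. \<forall>L\<ge>1.
     (INF u\<in>sphere 0 1. measure surface_measure (E L \<inter> geodesic_ball u (r / real L)) /
        measure surface_measure (geodesic_ball u (r / real L))) \<ge> \<rho>)"

text \<open>
  The suprema are taken in \<^typ>\<open>ennreal\<close>, so that the supremum over an empty \<open>E L\<close> is \<open>0\<close>.
\<close>

definition Linfty_Logvinenko_Sereda :: "(nat \<Rightarrow> (real ^ 'n) set) \<Rightarrow> bool" where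
  "Linfty_Logvinenko_Sereda E \<longleftrightarrow> (\<exists>C::real. C > 0 \<and> (\<forall>L\<ge>1. \<forall>Q\<in>spherical_polys L.
     (SUP u\<in>sphere 0 1. ennreal (cmod (Q u))) \<le> ennreal C * (SUP u\<in>E L. ennreal (cmod (Q u)))))"

lemma finite_degree_le: "finite {m :: 'n::finite \<Rightarrow> nat. (\<Sum>i\<in>UNIV. m i) \<le> L}"
proof (rule finite_subset)
  show "{m :: 'n \<Rightarrow> nat. (\<Sum>i\<in>UNIV. m i) \<le> L} \<subseteq> PiE UNIV (\<lambda>_. {..L})"
  proof
    fix m :: "'n \<Rightarrow> nat" assume "m \<in> {m. (\<Sum>i\<in>UNIV. m i) \<le> L}"
    then have "m i \<le> L" for i using member_le_sum[of i UNIV m] by (simp add: order_trans)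
    then show "m \<in> PiE UNIV (\<lambda>_. {..L})" by auto
  qed
  show "finite (PiE (UNIV :: 'n set) (\<lambda>_. {..L}))"
    by (intro finite_PiE) auto
qed

lemma space_surface_measure [simp]: "space (surface_measure :: (real ^ 'n) measure) = sphere 0 1"
  by (simp add: surface_measure_def space_scale_measure space_restrict_space)

lemma sgn_measurable_punctured_ball:
  "sgn \<in> restrict_space lborel (ball 0 1 - {0 :: real ^ 'n}) \<rightarrow>\<^sub>M restrict_space borel (sphere 0 1)"
proof (rule measurable_restrict_space3)
  have "(\<lambda>x :: real ^ 'n. x /\<^sub>R norm x) \<in> borel_measurable borel" by measurable
  then show "(sgn :: real ^ 'n \<Rightarrow> _) \<in> lborel \<rightarrow>\<^sub>M borel" by (simp add: sgn_div_norm[abs_def])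
qed (auto simp: norm_sgn)

lemma emeasure_surface_measure:
  fixes A :: "(real ^ 'n) set"
  assumes "A \<in> sets borel" "A \<subseteq> sphere 0 1"
  shows "A \<in> sets surface_measure"
    and "emeasure surface_measure A =
      of_nat CARD('n) * emeasure lborel {t *\<^sub>R u | t u. 0 < t \<and> t < 1 \<and> u \<in> A}"
proof -
  let ?D = "distr (restrict_space lborel (ball 0 1 - {0})) (restrict_space borel (sphere 0 1)) sgn
    :: (real ^ 'n) measure"
  have A: "A \<in> sets (restrict_space borel (sphere 0 1))"
    using assms by (auto simp: sets_restrict_space_iff)
  then show "A \<in> sets surface_measure"
    by (auto simp: surface_measure_def intro!: sets_completionI_sets)
  have *: "sgn -` A \<inter> (ball 0 1 - {0}) = {t *\<^sub>R u | t u. 0 < t \<and> t < 1 \<and> u \<in> A}"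
  proof (intro equalityI subsetI)
    fix x assume "x \<in> sgn -` A \<inter> (ball 0 1 - {0})"
    then have "x = norm x *\<^sub>R sgn x \<and> 0 < norm x \<and> norm x < 1 \<and> sgn x \<in> A"
      by (simp add: sgn_div_norm)
    then show "x \<in> {t *\<^sub>R u | t u. 0 < t \<and> t < 1 \<and> u \<in> A}" by blast
  next
    fix x assume "x \<in> {t *\<^sub>R u | t u. 0 < t \<and> t < 1 \<and> u \<in> A}"
    then obtain t u where x: "x = t *\<^sub>R u" "0 < t" "t < 1" "u \<in> A" by blast
    with assms(2) have "norm u = 1" by auto
    with x show "x \<in> sgn -` A \<inter> (ball 0 1 - {0})"
      by (auto simp: sgn_div_norm)
  qed
  have "emeasure surface_measure A = of_nat CARD('n) * emeasure ?D A"
    using A by (simp add: surface_measure_def emeasure_completion)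
  also have "emeasure ?D A = emeasure lborel (sgn -` A \<inter> (ball 0 1 - {0}))"
    using A by (subst emeasure_distr[OF sgn_measurable_punctured_ball])
      (auto simp: space_restrict_space emeasure_restrict_space)
  finally show "emeasure surface_measure A =
      of_nat CARD('n) * emeasure lborel {t *\<^sub>R u | t u. 0 < t \<and> t < 1 \<and> u \<in> A}"
    by (simp only: *)
qed

end

theory Submission
  imports Defs "HOL-Complex_Analysis.Complex_Analysis"
begin

text \<open>
  Let \<open>|Q|\<close> attain its maximum \<open>M\<close> over the sphere at \<open>u\<close>. On a great circle through \<open>u\<close>, \<open>Q\<close> is a
  trigonometric polynomial of degree at most \<open>L\<close>; after rescaling the angle by \<open>L\<close> it becomes an entire
  function \<open>f\<close> with \<open>|f z| \<le> M exp |Im z|\<close> and \<open>|f 0| = M\<close>. By Fubini, the density of \<open>E\<^sub>L\<close> in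
  \<open>B(u, r/L)\<close> yields a great circle on which \<open>E\<^sub>L\<close> contains \<open>N\<close> points at rescaled distance at most \<open>r\<close>
  from \<open>u\<close> and with rescaled separation bounded below independently of \<open>L\<close>. Interpolating \<open>f\<close> at these points, the
  error at \<open>0\<close> is at most \<open>2\<^sup>-\<^sup>N (M exp (3 r) + C\<^sub>N S)\<close> with \<open>S\<close> the supremum of \<open>|Q|\<close> over \<open>E\<^sub>L\<close>, so for \<open>N\<close> large depending only
  on \<open>r\<close> the term with \<open>M\<close> can be absorbed.
\<close>

unbundle no fps_syntax

subsection \<open>Interpolation of entire functions\<close>

text \<open>Zeros are divided out one at a time. The quotient \<open>(f z - f a) / (z - a)\<close>,
  completed at \<open>a\<close> by \<open>deriv f a\<close>, is again entire, and it still vanishes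
  at the remaining points because these differ from \<open>a\<close>.\<close>

lemma entire_factor_zeros:
  assumes "finite X" "f holomorphic_on UNIV" "\<And>x. x \<in> X \<Longrightarrow> f x = 0"
  obtains q where "q holomorphic_on UNIV" "\<And>z. f z = q z * (\<Prod>x\<in>X. z - x)"
proof -
  have "\<exists>q. q holomorphic_on UNIV \<and> (\<forall>z. f z = q z * (\<Prod>x\<in>X. z - x))"
    using assms
  proof (induction X arbitrary: f rule: finite_induct)
    case empty
    then show ?case by auto
  next
    case (insert a X)
    define g where "g = (\<lambda>z. if z = a then deriv f a else (f z - f a) / (z - a))"
    have g: "g holomorphic_on UNIV"
      unfolding g_def by (intro pole_lemma_open insert.prems) auto
    have fg: "f z = (z - a) * g z" for z
      using insert.prems(2)[of a] by (auto simp: g_def)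
    have "g x = 0" if "x \<in> X" for x
      using insert.prems(2)[of x] insert.prems(2)[of a] insert.hyps that by (auto simp: g_def)
    then obtain q where q: "q holomorphic_on UNIV" "\<And>z. g z = q z * (\<Prod>x\<in>X. z - x)"
      using insert.IH[OF g] by auto
    have "f z = q z * (\<Prod>x\<in>insert a X. z - x)" for z
      using insert.hyps by (simp add: fg q(2))
    with q(1) show ?case by blast
  qed
  then show ?thesis using that by blast
qed

lemma maximum_modulus_entire:
  assumes "q holomorphic_on UNIV" "R > 0" "\<And>z. cmod z = R \<Longrightarrow> cmod (q z) \<le> B" "cmod w \<le> R"
  shows "cmod (q w) \<le> B"
proof (rule maximum_modulus_frontier[of q "cball 0 R"])
  show "q holomorphic_on interior (cball 0 R)"
    using assms(1) by (rule holomorphic_on_subset) simp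
  show "continuous_on (closure (cball 0 R)) q"
    using assms(1) by (intro holomorphic_on_imp_continuous_on) (rule holomorphic_on_subset, auto)
qed (use assms in auto)

text \<open>The sum is the Lagrange interpolant of \<open>f\<close> at the nodes \<open>X\<close>.
  In each of the \<open>card X - 1\<close> factors of a basis polynomial the numerator is at most
  \<open>R + r\<close> by the location of the points, and the denominator is at least \<eta> by
  separation.\<close>

lemma norm_interpolant_le:
  fixes X :: "complex set"
  assumes "finite X" "X \<subseteq> cball 0 r" "\<eta> > 0" "cmod z \<le> R"
    and sep: "\<And>x y. x \<in> X \<Longrightarrow> y \<in> X \<Longrightarrow> x \<noteq> y \<Longrightarrow> \<eta> \<le> cmod (x - y)"
    and S: "\<And>x. x \<in> X \<Longrightarrow> cmod (f x) \<le> S"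
  shows "cmod (\<Sum>x\<in>X. f x * (\<Prod>y\<in>X-{x}. (z - y) / (x - y))) \<le> real (card X) * ((R + r) / \<eta>) ^ (card X - 1) * S"
proof -
  have "cmod (f x * (\<Prod>y\<in>X-{x}. (z - y) / (x - y))) \<le> ((R + r) / \<eta>) ^ (card X - 1) * S"
    if x: "x \<in> X" for x
  proof -
    have "cmod ((z - y) / (x - y)) \<le> (R + r) / \<eta>" if "y \<in> X - {x}" for y
    proof -
      have "cmod (z - y) \<le> R + r"
        using that assms(2,4) norm_triangle_ineq4[of z y] by (auto simp: subset_iff)
      moreover from this have "0 \<le> R + r" by (rule order_trans[OF norm_ge_zero])
      ultimately show ?thesis
        unfolding norm_divide using sep[of x y] x that \<open>\<eta> > 0\<close> by (intro frac_le) auto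
    qed
    then have "cmod (\<Prod>y\<in>X-{x}. (z - y) / (x - y)) \<le> (\<Prod>y\<in>X-{x}. (R + r) / \<eta>)"
      unfolding prod_norm[symmetric] by (intro prod_mono) auto
    also have "\<dots> = ((R + r) / \<eta>) ^ (card X - 1)"
      using x \<open>finite X\<close> by simp
    finally show ?thesis
      unfolding norm_mult using S[OF x] by (subst mult.commute) (intro mult_mono, auto intro: order_trans[OF norm_ge_zero])
  qed
  then have "cmod (\<Sum>x\<in>X. f x * (\<Prod>y\<in>X-{x}. (z - y) / (x - y))) \<le> (\<Sum>x\<in>X. ((R + r) / \<eta>) ^ (card X - 1) * S)"
    by (intro order_trans[OF norm_sum] sum_mono)
  then show ?thesis by (simp add: mult.assoc)
qed

text \<open>The difference of \<open>f\<close> and its Lagrange interpolant \<open>p\<close> equals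
  an entire \<open>q\<close> times the product of the \<open>z - x\<close>. On the circle of radius
  \<open>3 * r\<close> every factor has modulus at least \<open>2 * r\<close>, while at 0 it is at
  most \<open>r\<close>. The maximum principle for \<open>q\<close> therefore gains a factor 1/2 per
  node. The interpolant itself is controlled by \<open>S\<close> alone.\<close>

lemma interpolation_remez:
  fixes f :: "complex \<Rightarrow> complex" and N :: nat
  assumes hol: "f holomorphic_on UNIV" and X: "finite X" "card X = N" "X \<subseteq> cball 0 r"
    and "r > 0" "\<eta> > 0" "S \<ge> 0"
    and sep: "\<And>x y. x \<in> X \<Longrightarrow> y \<in> X \<Longrightarrow> x \<noteq> y \<Longrightarrow> \<eta> \<le> cmod (x - y)"
    and S: "\<And>x. x \<in> X \<Longrightarrow> cmod (f x) \<le> S"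
    and B: "\<And>z. cmod z = 3 * r \<Longrightarrow> cmod (f z) \<le> B"
  shows "cmod (f 0) \<le> B / 2 ^ N + 2 * real N * (4 * r / \<eta>) ^ (N - 1) * S"
proof -
  define p where "p = (\<lambda>z. \<Sum>x\<in>X. f x * (\<Prod>y\<in>X-{x}. (z - y) / (x - y)))"
  define K where "K = real N * (4 * r / \<eta>) ^ (N - 1) * S"
  have K: "K \<ge> 0" using assms by (simp add: K_def)
  have pK: "cmod (p z) \<le> K" if "cmod z \<le> 3 * r" for z
    using norm_interpolant_le[OF X(1,3) \<open>\<eta> > 0\<close> that sep S] X(2) by (simp add: p_def K_def)
  have pX: "p a = f a" if "a \<in> X" for a
  proof -
    have "p a = f a * (\<Prod>y\<in>X-{a}. (a - y) / (a - y)) + (\<Sum>x\<in>X-{a}. f x * (\<Prod>y\<in>X-{x}. (a - y) / (x - y)))"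
      unfolding p_def using that X(1) by (subst sum.remove[of _ a]) auto
    also have "(\<Prod>y\<in>X-{a}. (a - y) / (a - y)) = 1"
      by (rule prod.neutral) auto
    also have "(\<Sum>x\<in>X-{a}. f x * (\<Prod>y\<in>X-{x}. (a - y) / (x - y))) = 0"
      using that X(1) by (intro sum.neutral ballI) (auto simp: prod_zero_iff)
    finally show ?thesis by simp
  qed
  have "p holomorphic_on UNIV"
    unfolding p_def by (intro holomorphic_intros) auto
  then have "(\<lambda>z. f z - p z) holomorphic_on UNIV"
    using hol by (intro holomorphic_intros)
  then obtain q where q: "q holomorphic_on UNIV" "\<And>z. f z - p z = q z * (\<Prod>x\<in>X. z - x)"
    using entire_factor_zeros[OF X(1), of "\<lambda>z. f z - p z"] pX by auto
  have "cmod (q z) \<le> (B + K) / (2 * r) ^ N" if z: "cmod z = 3 * r" for z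
  proof -
    have "(\<Prod>x\<in>X. 2 * r) \<le> (\<Prod>x\<in>X. cmod (z - x))"
    proof (rule prod_mono)
      fix x assume "x \<in> X"
      then have "cmod x \<le> r" using X(3) by auto
      then show "0 \<le> 2 * r \<and> 2 * r \<le> cmod (z - x)"
        using z norm_triangle_ineq2[of z x] \<open>r > 0\<close> by auto
    qed
    then have "cmod (q z) * (2 * r) ^ N \<le> cmod (q z) * cmod (\<Prod>x\<in>X. z - x)"
      using X(2) by (intro mult_left_mono) (auto simp: prod_norm)
    also have "\<dots> = cmod (f z - p z)" by (simp add: q(2) norm_mult)
    also have "\<dots> \<le> B + K"
      using B[OF z] pK[of z] z norm_triangle_ineq4[of "f z" "p z"] by simp
    finally show ?thesis using \<open>r > 0\<close> by (simp add: field_simps)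
  qed
  then have q0: "cmod (q 0) \<le> (B + K) / (2 * r) ^ N"
    using \<open>r > 0\<close> maximum_modulus_entire[OF q(1), of "3 * r" "(B + K) / (2 * r) ^ N" 0] by simp
  have "cmod (\<Prod>x\<in>X. 0 - x) \<le> (\<Prod>x\<in>X. r)"
    unfolding prod_norm[symmetric] using X(3) by (intro prod_mono) auto
  then have "cmod (f 0 - p 0) \<le> (B + K) / (2 * r) ^ N * r ^ N"
    unfolding q(2) norm_mult using X(2) q0 by (intro mult_mono) (auto intro: order_trans[OF norm_ge_zero])
  also have "\<dots> = B / 2 ^ N + K / 2 ^ N"
    using \<open>r > 0\<close> by (simp add: power_mult_distrib field_simps)
  \<comment> \<open>This \<open>K\<close> and the one bounding \<open>p 0\<close> account for the
    factor 2 in the conclusion.\<close>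
  also have "K / 2 ^ N \<le> K"
    using K by (simp add: divide_le_eq mult_le_cancel_left1)
  finally show ?thesis
    using pK[of 0] \<open>r > 0\<close> norm_triangle_sub[of "f 0" "p 0"] by (simp add: K_def)
qed

subsection \<open>Polynomials on great circles\<close>

text \<open>For orthonormal \<open>u\<close>, \<open>v\<close> and real \<open>z\<close> this is the
  polynomial with coefficients \<open>c\<close> at the point of the great circle through
  \<open>u\<close> and \<open>v\<close> with angle \<open>z\<close>. Complex angles make complex
  analysis available.\<close>

definition circle_poly where
  "circle_poly L c u v z = (\<Sum>m | (\<Sum>i\<in>UNIV. m i) \<le> L. c m *
     (\<Prod>i\<in>UNIV. (complex_of_real (u $ i) * cos z + complex_of_real (v $ i) * sin z) ^ m i))"
  for u v :: "real ^ 'n" and c :: "('n \<Rightarrow> nat) \<Rightarrow> complex"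

lemma holomorphic_circle_poly [holomorphic_intros]:
  assumes "f holomorphic_on A"
  shows "(\<lambda>z. circle_poly L c u v (f z)) holomorphic_on A"
  unfolding circle_poly_def by (intro holomorphic_intros assms)

lemma circle_poly_uminus: "circle_poly L c u (- v) (- z) = circle_poly L c u v z"
  by (simp add: circle_poly_def)

text \<open>In the variable \<open>w = exp (\<i> * z)\<close> the function becomes \<open>w\<close>
  to the power \<open>-L\<close> times a polynomial \<open>G\<close>. Real angles correspond to the
  unit circle, where \<open>G\<close> is bounded by \<open>M\<close>, and the upper half plane is
  mapped into the unit disc. The maximum principle for \<open>G\<close> then leaves only the factor
  \<open>exp (L * Im z)\<close>.\<close>

lemma circle_poly_upper_half_plane:
  fixes c :: "('n::finite \<Rightarrow> nat) \<Rightarrow> complex"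
  assumes M: "\<And>t::real. cmod (circle_poly L c u v t) \<le> M" and z: "Im z \<ge> 0"
  shows "cmod (circle_poly L c u v z) \<le> M * exp (L * Im z)"
proof -
  \<comment> \<open>By Euler's formulas the \<open>i\<close>-th coordinate of the circle is
    \<open>\<alpha> i * w + \<beta> i / w\<close>. Multiplication by \<open>w\<close> removes the
    pole, and the extra power of \<open>w\<close> in \<open>G\<close> brings monomials of lower
    degree to the common factor \<open>w ^ L\<close>.\<close>
  define \<alpha> where "\<alpha> i = (complex_of_real (u $ i) - \<i> * complex_of_real (v $ i)) / 2" for i
  define \<beta> where "\<beta> i = (complex_of_real (u $ i) + \<i> * complex_of_real (v $ i)) / 2" for i
  define G where "G w = (\<Sum>m | (\<Sum>i\<in>UNIV. m i) \<le> L. c m * (w ^ (L - (\<Sum>i\<in>UNIV. m i)) *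
    (\<Prod>i\<in>UNIV. (\<alpha> i * w ^ 2 + \<beta> i) ^ m i)))" for w :: complex
  have G: "G (exp (\<i> * z)) = exp (\<i> * z) ^ L * circle_poly L c u v z" for z
  proof -
    let ?w = "exp (\<i> * z)"
    have w: "exp (- (\<i> * z)) = inverse ?w" by (rule exp_minus)
    have lin: "\<alpha> i * ?w ^ 2 + \<beta> i = ?w * (complex_of_real (u $ i) * cos z + complex_of_real (v $ i) * sin z)" for i
      unfolding \<alpha>_def \<beta>_def cos_exp_eq sin_exp_eq w
      by (simp add: field_simps power2_eq_square)
    have "?w ^ (L - (\<Sum>i\<in>UNIV. m i)) * (\<Prod>i\<in>UNIV. (\<alpha> i * ?w ^ 2 + \<beta> i) ^ m i) =
        ?w ^ L * (\<Prod>i\<in>UNIV. (complex_of_real (u $ i) * cos z + complex_of_real (v $ i) * sin z) ^ m i)"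
      if "(\<Sum>i\<in>UNIV. m i) \<le> L" for m
    proof -
      have "(\<Prod>i\<in>UNIV. (\<alpha> i * ?w ^ 2 + \<beta> i) ^ m i) = ?w ^ (\<Sum>i\<in>UNIV. m i) *
         (\<Prod>i\<in>UNIV. (complex_of_real (u $ i) * cos z + complex_of_real (v $ i) * sin z) ^ m i)"
        by (simp add: lin power_mult_distrib prod.distrib power_sum)
      then show ?thesis
        using that by (simp add: mult.assoc[symmetric] power_add[symmetric])
    qed
    then show ?thesis
      unfolding G_def circle_poly_def sum_distrib_left
      by (intro sum.cong refl) (simp add: mult_ac)
  qed
  have G1: "cmod (G w) \<le> M" if "cmod w = 1" for w
  proof -
    obtain t :: real where t: "w = exp (\<i> * t)"
      using \<open>cmod w = 1\<close> by (metis complex_norm_eq_1_exp)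
    then have "cmod (G w) = cmod (circle_poly L c u v t)"
      by (simp add: G norm_mult norm_power)
    with M show ?thesis by simp
  qed
  have Gh: "G holomorphic_on UNIV"
    unfolding G_def by (intro holomorphic_intros)
  have "cmod (exp (\<i> * z)) \<le> 1" using z by simp
  with maximum_modulus_entire[OF Gh zero_less_one G1] have "cmod (G (exp (\<i> * z))) \<le> M"
    by blast
  moreover have "cmod (G (exp (\<i> * z))) = exp (- Im z) ^ L * cmod (circle_poly L c u v z)"
    by (simp add: G norm_mult norm_power)
  moreover have "exp (- Im z) ^ L = inverse (exp (L * Im z))"
    by (simp add: exp_of_nat_mult[symmetric] exp_minus[symmetric])
  ultimately show ?thesis by (simp add: field_simps)
qed

text \<open>Changing the signs of both \<open>v\<close> and \<open>z\<close> leaves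
  \<open>circle_poly\<close> fixed, which reduces the lower half plane to the upper one.\<close>

lemma circle_poly_growth:
  fixes c :: "('n::finite \<Rightarrow> nat) \<Rightarrow> complex"
  assumes M: "\<And>t::real. cmod (circle_poly L c u v t) \<le> M"
  shows "cmod (circle_poly L c u v z) \<le> M * exp (L * \<bar>Im z\<bar>)"
proof (cases "Im z \<ge> 0")
  case True
  then show ?thesis using circle_poly_upper_half_plane[OF M] by simp
next
  case False
  have "cmod (circle_poly L c u (- v) t) \<le> M" for t :: real
    using M[of "- t"] circle_poly_uminus[of L c u v "- of_real t"] by simp
  from circle_poly_upper_half_plane[OF this, of "- z"] False show ?thesis
    by (simp add: circle_poly_uminus)
qed

subsection \<open>Slices of sets of positive measure\<close>

text \<open>Greedy choice: the intervals of radius \<eta> around fewer than \<open>N\<close> chosen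
  points cannot cover \<open>T\<close>, since their total length is below its measure. Any uncovered
  point of \<open>T\<close> can be added.\<close>

lemma separated_points:
  fixes T :: "real set"
  assumes T: "T \<in> sets lborel" and "\<eta> \<ge> 0" and big: "emeasure lborel T > ennreal (2 * real N * \<eta>)"
  obtains X where "finite X" "card X = N" "X \<subseteq> T"
    "\<And>x y. x \<in> X \<Longrightarrow> y \<in> X \<Longrightarrow> x \<noteq> y \<Longrightarrow> \<eta> \<le> \<bar>x - y\<bar>"
proof -
  have "\<exists>X. finite X \<and> card X = k \<and> X \<subseteq> T \<and> (\<forall>x\<in>X. \<forall>y\<in>X. x \<noteq> y \<longrightarrow> \<eta> \<le> \<bar>x - y\<bar>)"
    if "k \<le> N" for k
    using that
  proof (induction k)
    case 0
    then show ?case by (intro exI[of _ "{}"]) auto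
  next
    case (Suc k)
    then obtain X where X: "finite X" "card X = k" "X \<subseteq> T"
      "\<And>x y. x \<in> X \<Longrightarrow> y \<in> X \<Longrightarrow> x \<noteq> y \<Longrightarrow> \<eta> \<le> \<bar>x - y\<bar>" by auto
    have "emeasure lborel (\<Union>x\<in>X. {x - \<eta>..x + \<eta>}) \<le> (\<Sum>x\<in>X. emeasure lborel {x - \<eta>..x + \<eta>})"
      using X(1) by (intro emeasure_subadditive_finite) auto
    also have "\<dots> = (\<Sum>x\<in>X. ennreal (2 * \<eta>))"
      using \<open>\<eta> \<ge> 0\<close> by (intro sum.cong) auto
    also have "\<dots> = ennreal (2 * real k * \<eta>)"
      using \<open>\<eta> \<ge> 0\<close> X(2) by (simp add: ennreal_of_nat_eq_real_of_nat ennreal_mult[symmetric] mult_ac)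
    also have "\<dots> \<le> ennreal (2 * real N * \<eta>)"
      using Suc.prems \<open>\<eta> \<ge> 0\<close> by (intro ennreal_leI mult_right_mono) auto
    also have "\<dots> < emeasure lborel T" by (rule big)
    finally have less: "emeasure lborel (\<Union>x\<in>X. {x - \<eta>..x + \<eta>}) < emeasure lborel T" .
    have "(\<Union>x\<in>X. {x - \<eta>..x + \<eta>}) \<in> sets lborel"
      using X(1) by (intro sets.finite_UN) auto
    with less have "\<not> T \<subseteq> (\<Union>x\<in>X. {x - \<eta>..x + \<eta>})"
      by (meson emeasure_mono not_le)
    then obtain t where t0: "t \<in> T" "t \<notin> (\<Union>x\<in>X. {x - \<eta>..x + \<eta>})" by blast
    then have t: "t \<in> T" "\<And>x. x \<in> X \<Longrightarrow> \<not> (x - \<eta> \<le> t \<and> t \<le> x + \<eta>)" by simp_all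
    have "\<eta> \<le> \<bar>t - x\<bar>" if "x \<in> X" for x using t(2)[OF that] by linarith
    moreover have "t \<notin> X" using t(2)[of t] \<open>\<eta> \<ge> 0\<close> by auto
    ultimately show ?case
      using X t(1) by (intro exI[of _ "insert t X"]) (auto simp: abs_minus_commute)
  qed
  from this[of N] that show ?thesis by blast
qed

lemma nn_integral_lborel_translate:
  fixes t :: "'a::euclidean_space"
  assumes "f \<in> borel_measurable borel"
  shows "(\<integral>\<^sup>+x. f (t + x) \<partial>lborel) = (\<integral>\<^sup>+x. f x \<partial>lborel)"
proof -
  have "(\<integral>\<^sup>+x. f x \<partial>distr lborel borel ((+) t)) = (\<integral>\<^sup>+x. f (t + x) \<partial>lborel)"
    using assms by (subst nn_integral_distr) auto
  then show ?thesis by (simp add: lborel_distr_plus)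
qed

lemma norm_orthogonal_part:
  fixes u x :: "'a::real_inner"
  assumes "norm u = 1"
  shows "(norm (x - (x \<bullet> u) *\<^sub>R u))\<^sup>2 = (norm x)\<^sup>2 - (x \<bullet> u)\<^sup>2"
proof -
  have "u \<bullet> u = 1" using assms by (simp add: dot_square_norm)
  then show ?thesis
    unfolding power2_norm_eq_inner inner_diff_left inner_diff_right inner_scaleR_left inner_scaleR_right
    by (simp add: inner_commute power2_eq_square)
qed

text \<open>This is Fubini along the direction \<open>u\<close> without choosing coordinates. Base
  points range over a slab of width 1 in direction \<open>u\<close>, so the line through a point of
  \<open>A\<close> meets the slab in a segment of length exactly 1 and every point is counted once.
  Truncating the slab at transverse distance 2 loses nothing for \<open>A\<close> inside
  \<open>cball 0 2\<close> and makes it bounded.\<close>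

lemma nn_integral_slab_slices:
  fixes u :: "'a::euclidean_space"
  assumes u: "norm u = 1" and A: "A \<in> sets borel" "A \<subseteq> cball 0 2"
  shows "emeasure lborel A = (\<integral>\<^sup>+x. indicator {x. 0 \<le> x \<bullet> u \<and> x \<bullet> u \<le> 1 \<and> norm (x - (x \<bullet> u) *\<^sub>R u) \<le> 2} x *
    emeasure lborel {s. x + s *\<^sub>R u \<in> A} \<partial>lborel)"
proof -
  define K where "K = {x. 0 \<le> x \<bullet> u \<and> x \<bullet> u \<le> 1 \<and> norm (x - (x \<bullet> u) *\<^sub>R u) \<le> 2}"
  have uu: "u \<bullet> u = 1" using u by (simp add: dot_square_norm)
  have K[measurable]: "K \<in> sets borel"
    unfolding K_def by (intro borel_closed closed_Collect_conj closed_Collect_le continuous_intros)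
  note A(1)[measurable]
  have shift: "(\<integral>\<^sup>+x. indicator K x * indicator A (x + s *\<^sub>R u) \<partial>lborel) =
      (\<integral>\<^sup>+x. indicator K (x - s *\<^sub>R u) * indicator A x \<partial>lborel :: ennreal)" for s
    using nn_integral_lborel_translate[of "\<lambda>x. indicator K (x - s *\<^sub>R u) * indicator A x" "s *\<^sub>R u"]
    by (simp add: add.commute)
  have one: "(\<integral>\<^sup>+s. indicator K (x - s *\<^sub>R u) \<partial>lborel) = (1::ennreal)" if "x \<in> A" for x
  proof -
    have "x - s *\<^sub>R u - ((x - s *\<^sub>R u) \<bullet> u) *\<^sub>R u = x - (x \<bullet> u) *\<^sub>R u" for s
      using uu by (simp add: inner_diff_left algebra_simps)
    moreover have "norm (x - (x \<bullet> u) *\<^sub>R u) \<le> norm x"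
      by (rule power2_le_imp_le) (simp_all only: norm_orthogonal_part[OF u] norm_ge_zero, simp)
    moreover have "norm x \<le> 2" using that A(2) by auto
    moreover have "(x - s *\<^sub>R u) \<bullet> u = x \<bullet> u - s" for s
      using uu by (simp add: inner_diff_left)
    ultimately have "x - s *\<^sub>R u \<in> K \<longleftrightarrow> s \<in> {x \<bullet> u - 1..x \<bullet> u}" for s
      unfolding K_def mem_Collect_eq atLeastAtMost_iff by (smt (verit))
    then have "(\<integral>\<^sup>+s. indicator K (x - s *\<^sub>R u) \<partial>lborel) = (\<integral>\<^sup>+s. indicator {x \<bullet> u - 1..x \<bullet> u} s \<partial>(lborel :: real measure) :: ennreal)"
      by (intro nn_integral_cong) (auto simp: indicator_def)
    also have "\<dots> = 1" by simp
    finally show ?thesis .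
  qed
  have "(\<integral>\<^sup>+x. indicator K x * emeasure lborel {s. x + s *\<^sub>R u \<in> A} \<partial>lborel) =
      (\<integral>\<^sup>+x. (\<integral>\<^sup>+s. indicator K x * indicator A (x + s *\<^sub>R u) \<partial>lborel) \<partial>lborel)"
  proof (intro nn_integral_cong)
    fix x
    have "(\<integral>\<^sup>+s. indicator K x * indicator A (x + s *\<^sub>R u) \<partial>lborel) =
      indicator K x * (\<integral>\<^sup>+s. indicator {s. x + s *\<^sub>R u \<in> A} s \<partial>lborel :: ennreal)"
      by (subst nn_integral_cmult[symmetric]) (auto simp: indicator_def)
    then show "indicator K x * emeasure lborel {s. x + s *\<^sub>R u \<in> A} =
      (\<integral>\<^sup>+s. indicator K x * indicator A (x + s *\<^sub>R u) \<partial>lborel)" by simp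
  qed
  also have "\<dots> = (\<integral>\<^sup>+s. (\<integral>\<^sup>+x. indicator K x * indicator A (x + s *\<^sub>R u) \<partial>lborel) \<partial>lborel)"
    by (rule lborel_pair.Fubini') measurable
  also have "\<dots> = (\<integral>\<^sup>+s. (\<integral>\<^sup>+x. indicator K (x - s *\<^sub>R u) * indicator A x \<partial>lborel) \<partial>lborel)"
    by (simp only: shift)
  also have "\<dots> = (\<integral>\<^sup>+x. (\<integral>\<^sup>+s. indicator K (x - s *\<^sub>R u) * indicator A x \<partial>lborel) \<partial>lborel)"
    by (rule lborel_pair.Fubini') measurable
  also have "\<dots> = (\<integral>\<^sup>+x. indicator A x \<partial>lborel)"
  proof (intro nn_integral_cong)
    fix x
    show "(\<integral>\<^sup>+s. indicator K (x - s *\<^sub>R u) * indicator A x \<partial>lborel) = (indicator A x :: ennreal)"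
      by (cases "x \<in> A") (auto simp: one)
  qed
  also have "\<dots> = emeasure lborel A" by simp
  finally show ?thesis by (simp add: K_def)
qed

text \<open>The truncated slab has axial part at most 1 and transverse part at most 2, hence lies in
  the ball of radius 3.\<close>

lemma emeasure_le_slices:
  fixes u :: "'a::euclidean_space"
  assumes u: "norm u = 1" and A: "A \<in> sets borel" "A \<subseteq> cball 0 2"
    and le: "\<And>x. emeasure lborel {s. x + s *\<^sub>R u \<in> A} \<le> m"
  shows "emeasure lborel A \<le> m * emeasure lborel (cball (0::'a) 3)"
proof -
  have "indicator {x. 0 \<le> x \<bullet> u \<and> x \<bullet> u \<le> 1 \<and> norm (x - (x \<bullet> u) *\<^sub>R u) \<le> 2} x * emeasure lborel {s. x + s *\<^sub>R u \<in> A}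
      \<le> m * indicator (cball (0::'a) 3) x" for x
  proof -
    have "norm x \<le> 3" if "0 \<le> x \<bullet> u" "x \<bullet> u \<le> 1" "norm (x - (x \<bullet> u) *\<^sub>R u) \<le> 2"
      using that u norm_triangle_sub[of x "(x \<bullet> u) *\<^sub>R u"] by simp
    with le[of x] show ?thesis by (auto simp: indicator_def)
  qed
  then have "emeasure lborel A \<le> (\<integral>\<^sup>+x. m * indicator (cball (0::'a) 3) x \<partial>lborel)"
    unfolding nn_integral_slab_slices[OF u A] by (intro nn_integral_mono)
  also have "\<dots> = m * emeasure lborel (cball (0::'a) 3)" by (rule nn_integral_cmult_indicator) simp
  finally show ?thesis .
qed

text \<open>The part \<open>A1\<close> of \<open>A\<close> close to the axis through
  \<open>u\<close> is thin in a direction \<open>w\<close> orthogonal to \<open>u\<close>, so its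
  measure is at most \<open>2 * \<kappa>\<close> times the volume of the ball. The rest is then too
  large for all its slices along \<open>u\<close> to be short. A slice at distance at least \<kappa>
  from the axis is wanted because only there does distance along the line control the angle seen
  from the origin.\<close>

lemma exists_large_slice:
  fixes u :: "'a::euclidean_space"
  assumes dim: "DIM('a) \<ge> 2" and u: "norm u = 1" and A: "A \<in> sets borel" "A \<subseteq> cball 0 2"
    and "\<kappa> > 0" "\<mu> > 0"
    and big: "emeasure lborel A > ennreal (2 * \<kappa> + \<mu>) * emeasure lborel (cball (0::'a) 3)"
  obtains y where "y \<bullet> u = 0" "norm y \<ge> \<kappa>" "emeasure lborel {s. y + s *\<^sub>R u \<in> A} > ennreal \<mu>"
proof -
  have uu: "u \<bullet> u = 1" using u by (simp add: dot_square_norm)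
  define P where "P x = x - (x \<bullet> u) *\<^sub>R u" for x
  define A1 where "A1 = A \<inter> {x. norm (P x) < \<kappa>}"
  define A2 where "A2 = A \<inter> {x. norm (P x) \<ge> \<kappa>}"
  let ?V = "emeasure lborel (cball (0::'a) 3)"
  have PA: "A1 \<in> sets borel" "A1 \<subseteq> cball 0 2" "A2 \<in> sets borel" "A2 \<subseteq> cball 0 2"
    using A unfolding A1_def A2_def P_def
    by (auto intro!: sets.Int borel_closed borel_open closed_Collect_le open_Collect_less continuous_intros)
  obtain w :: 'a where w: "norm w = 1" "u \<bullet> w = 0"
  proof -
    obtain w0 where "w0 \<noteq> 0" "orthogonal u w0"
      using orthogonal_to_vector_exists[OF dim] by blast
    then have "norm (sgn w0) = 1" "u \<bullet> sgn w0 = 0"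
      by (auto simp: norm_sgn orthogonal_def sgn_div_norm)
    then show ?thesis by (rule that)
  qed
  then have ww: "w \<bullet> w = 1" by (simp add: dot_square_norm)
  have "emeasure lborel {s. x + s *\<^sub>R w \<in> A1} \<le> ennreal (2 * \<kappa>)" for x
  proof -
    have "{s. x + s *\<^sub>R w \<in> A1} \<subseteq> {- \<kappa> - x \<bullet> w..\<kappa> - x \<bullet> w}"
    proof
      fix s assume "s \<in> {s. x + s *\<^sub>R w \<in> A1}"
      then have "norm (P (x + s *\<^sub>R w)) < \<kappa>" by (simp add: A1_def)
      moreover have "P (x + s *\<^sub>R w) \<bullet> w = x \<bullet> w + s"
        using w ww by (simp add: P_def inner_diff_left inner_add_left)
      ultimately have "\<bar>x \<bullet> w + s\<bar> < \<kappa>"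
        using Cauchy_Schwarz_ineq2[of "P (x + s *\<^sub>R w)" w] w by simp
      then show "s \<in> {- \<kappa> - x \<bullet> w..\<kappa> - x \<bullet> w}" by auto
    qed
    then have "emeasure lborel {s. x + s *\<^sub>R w \<in> A1} \<le> emeasure lborel {- \<kappa> - x \<bullet> w..\<kappa> - x \<bullet> w}"
      by (rule emeasure_mono) simp
    also have "\<dots> = ennreal (2 * \<kappa>)" using \<open>\<kappa> > 0\<close> by simp
    finally show ?thesis .
  qed
  from emeasure_le_slices[OF w(1) PA(1,2) this]
  have A1: "emeasure lborel A1 \<le> ennreal (2 * \<kappa>) * ?V" .
  have "\<not> (\<forall>x. emeasure lborel {s. x + s *\<^sub>R u \<in> A2} \<le> ennreal \<mu>)"
  proof
    assume "\<forall>x. emeasure lborel {s. x + s *\<^sub>R u \<in> A2} \<le> ennreal \<mu>"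
    with emeasure_le_slices[OF u PA(3,4)] have A2: "emeasure lborel A2 \<le> ennreal \<mu> * ?V" by blast
    have "emeasure lborel A \<le> emeasure lborel A1 + emeasure lborel A2"
    proof -
      have "A = A1 \<union> A2" by (auto simp: A1_def A2_def)
      then show ?thesis using PA emeasure_subadditive[of A1 lborel A2] by simp
    qed
    also have "\<dots> \<le> ennreal (2 * \<kappa>) * ?V + ennreal \<mu> * ?V" by (intro add_mono A1 A2)
    also have "\<dots> = ennreal (2 * \<kappa> + \<mu>) * ?V"
      using \<open>\<kappa> > 0\<close> \<open>\<mu> > 0\<close> by (simp add: distrib_right)
    finally show False using big by simp
  qed
  then obtain x where x: "emeasure lborel {s. x + s *\<^sub>R u \<in> A2} > ennreal \<mu>"
    by (auto simp: not_le)
  \<comment> \<open>The base point \<open>x\<close> is replaced by its projection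
    \<open>P x\<close>, which merely translates the set of parameters \<open>s\<close>.\<close>
  have Px: "P (x + s *\<^sub>R u) = P x" for s
    using uu by (simp add: P_def inner_add_left algebra_simps)
  have "{s. x + s *\<^sub>R u \<in> A2} \<noteq> {}" using x by (metis emeasure_empty not_less_zero)
  then have "norm (P x) \<ge> \<kappa>" by (auto simp: A2_def Px)
  moreover have "P x \<bullet> u = 0" using uu by (simp add: P_def inner_diff_left)
  moreover have "emeasure lborel {s. P x + s *\<^sub>R u \<in> A} > ennreal \<mu>"
  proof -
    note A(1)[measurable]
    have "emeasure lborel {s. x + s *\<^sub>R u \<in> A2} \<le> emeasure lborel {s. x + s *\<^sub>R u \<in> A}"
      by (rule emeasure_mono) (auto simp: A2_def)
    also have "{s. x + s *\<^sub>R u \<in> A} = {s. P x + (s + x \<bullet> u) *\<^sub>R u \<in> A}"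
      by (simp add: P_def algebra_simps)
    also have "emeasure lborel \<dots> = emeasure lborel {s. P x + s *\<^sub>R u \<in> A}"
    proof -
      have "emeasure (distr lborel borel ((+) (x \<bullet> u))) {s. P x + s *\<^sub>R u \<in> A} = emeasure lborel {s. P x + (s + x \<bullet> u) *\<^sub>R u \<in> A}"
        by (subst emeasure_distr) (auto intro!: arg_cong[where f = "emeasure lborel"] simp: add.commute)
      then show ?thesis by (simp add: lborel_distr_plus)
    qed
    finally show ?thesis using x by (rule order.strict_trans2[rotated])
  qed
  ultimately show ?thesis using that by blast
qed

section \<open>Volume under injective linear maps\<close>

text \<open>
  Uniqueness of Haar measure for the translation-invariant measure \<open>B \<mapsto> vol (T\<^sup>-\<^sup>1 B)\<close>. The change
  of variables formula in the library needs an index type of class \<^class>\<open>wellorder\<close>.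
\<close>
lemma emeasure_linear_vimage:
  fixes T :: "'a::euclidean_space \<Rightarrow> 'a"
  assumes T: "linear T" "inj T" and B[measurable]: "B \<in> sets borel"
  shows "emeasure lborel B * emeasure lborel (T -` ball 0 1) = emeasure lborel (ball (0::'a) 1) * emeasure lborel (T -` B)"
proof -
  have T_meas[measurable]: "T \<in> borel_measurable borel"
    using T(1) by (intro borel_measurable_continuous_onI linear_continuous_on) (simp add: linear_conv_bounded_linear)
  have vim[measurable]: "T -` C \<in> sets borel" if "C \<in> sets borel" for C
    using measurable_sets_borel[OF T_meas that] .
  have vim_int: "emeasure lborel (T -` C) = (\<integral>\<^sup>+z. indicator C (T z) \<partial>lborel)" if "C \<in> sets borel" for C
  proof -
    have "(\<lambda>z. indicator C (T z)) = (indicator (T -` C) :: 'a \<Rightarrow> ennreal)"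
      by (auto simp: indicator_def)
    then show ?thesis using vim[OF that] by simp
  qed
  define b where "b = ball (0::'a) 1"
  have [measurable]: "b \<in> sets borel" by (simp add: b_def)
  have inv: "(\<integral>\<^sup>+z. indicator B (x + T z) \<partial>lborel) = emeasure lborel (T -` B)" for x
  proof -
    obtain x' where x': "x = T x'"
      using linear_injective_imp_surjective[OF T] by (metis surjE)
    have "emeasure lborel (T -` B) = (\<integral>\<^sup>+z. indicator B (T z) \<partial>lborel)"
      by (rule vim_int) measurable
    also have "\<dots> = (\<integral>\<^sup>+z. indicator B (T z) \<partial>distr lborel borel ((+) x'))"
      by (simp add: lborel_distr_plus)
    also have "\<dots> = (\<integral>\<^sup>+z. indicator B (x + T z) \<partial>lborel)"
      by (subst nn_integral_distr) (auto simp: x' linear_add[OF T(1)])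
    finally show ?thesis ..
  qed
  have shift: "(\<integral>\<^sup>+x. indicator b x * indicator B (x + T z) \<partial>lborel) =
      (\<integral>\<^sup>+x. indicator b (x - T z) * indicator B x \<partial>lborel :: ennreal)" for z
  proof -
    have "(\<lambda>x. indicator b (x - T z) * indicator B x :: ennreal) \<in> borel_measurable borel" by measurable
    from nn_integral_lborel_translate[OF this, of "T z"] show ?thesis by (simp add: add.commute)
  qed
  have inv_ball: "(\<integral>\<^sup>+z. indicator b (x - T z) \<partial>lborel) = emeasure lborel (T -` b)" for x
  proof -
    obtain x' where x': "x = T x'"
      using linear_injective_imp_surjective[OF T] by (metis surjE)
    have "emeasure lborel (T -` b) = (\<integral>\<^sup>+z. indicator b (T z) \<partial>lborel)"
      by (rule vim_int) measurable
    also have "\<dots> = (\<integral>\<^sup>+z. indicator b (T z) \<partial>distr lborel borel ((+) (- x')))"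
      by (simp add: lborel_distr_plus)
    also have "\<dots> = (\<integral>\<^sup>+z. indicator b (x - T z) \<partial>lborel)"
      by (subst nn_integral_distr)
        (auto simp: b_def x' linear_add[OF T(1)] linear_neg[OF T(1)] linear_diff[OF T(1)] norm_minus_commute indicator_def intro!: nn_integral_cong)
    finally show ?thesis ..
  qed
  \<comment> \<open>The double integral of \<open>indicator b x * indicator B (x + T z)\<close> is
    evaluated in two ways. Integrating over \<open>z\<close> directly gives the left side.
    Substituting \<open>x - T z\<close> for \<open>x\<close> first and then integrating over
    \<open>z\<close> gives the right side, where the symmetry of the ball enters through
    \<open>inv_ball\<close>.\<close>
  have "emeasure lborel b * emeasure lborel (T -` B) =
      (\<integral>\<^sup>+x. emeasure lborel (T -` B) * indicator b x \<partial>lborel)"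
    by (subst nn_integral_cmult_indicator) (auto simp: mult.commute)
  also have "\<dots> = (\<integral>\<^sup>+x. (\<integral>\<^sup>+z. indicator b x * indicator B (x + T z) \<partial>lborel) \<partial>lborel)"
    by (intro nn_integral_cong) (simp add: nn_integral_cmult inv mult.commute)
  also have "\<dots> = (\<integral>\<^sup>+z. (\<integral>\<^sup>+x. indicator b x * indicator B (x + T z) \<partial>lborel) \<partial>lborel)"
    by (rule lborel_pair.Fubini') measurable
  also have "\<dots> = (\<integral>\<^sup>+z. (\<integral>\<^sup>+x. indicator b (x - T z) * indicator B x \<partial>lborel) \<partial>lborel)"
    by (simp only: shift)
  also have "\<dots> = (\<integral>\<^sup>+x. (\<integral>\<^sup>+z. indicator b (x - T z) * indicator B x \<partial>lborel) \<partial>lborel)"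
    by (rule lborel_pair.Fubini') measurable
  also have "\<dots> = (\<integral>\<^sup>+x. emeasure lborel (T -` b) * indicator B x \<partial>lborel)"
    by (intro nn_integral_cong) (simp add: nn_integral_multc inv_ball)
  also have "\<dots> = emeasure lborel B * emeasure lborel (T -` b)"
    by (subst nn_integral_cmult_indicator) (auto simp: mult.commute)
  finally show ?thesis by (simp add: b_def)
qed

text \<open>\<open>D\<close> stands for the absolute determinant of \<open>T\<close> and cancels
  when the measures of two sets are compared. It is well defined and positive because the preimage
  of the unit ball is bounded, by a linear left inverse of \<open>T\<close>, and contains a ball, by
  boundedness of \<open>T\<close>.\<close>

lemma measure_linear_vimage:
  fixes T :: "'a::euclidean_space \<Rightarrow> 'a"
  assumes T: "linear T" "inj T"
  obtains D where "D > 0" "\<And>B. B \<in> sets borel \<Longrightarrow> measure lborel B = D * measure lborel (T -` B)"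
proof
  let ?b = "ball (0::'a) 1"
  obtain g where g: "linear g" "g \<circ> T = id"
    using linear_injective_left_inverse[OF T] by auto
  have "T -` ?b \<subseteq> g ` ?b"
  proof
    fix x assume "x \<in> T -` ?b"
    moreover have "x = g (T x)" using g(2) by (metis comp_apply id_apply)
    ultimately show "x \<in> g ` ?b" by blast
  qed
  moreover have "bounded (g ` ?b)"
    using g(1) by (intro bounded_linear_image) (auto simp: linear_conv_bounded_linear)
  ultimately have fin: "emeasure lborel (T -` ?b) < \<infinity>"
    by (intro emeasure_bounded_finite) (rule bounded_subset)
  obtain K where K: "K > 0" "\<And>x. norm (T x) \<le> norm x * K"
    using T(1) bounded_linear.pos_bounded[of T] by (auto simp: linear_conv_bounded_linear)
  have "ball 0 (1 / K) \<subseteq> T -` ?b"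
  proof
    fix x :: 'a assume "x \<in> ball 0 (1 / K)"
    then have "norm x * K < 1" using K(1) by (simp add: field_simps)
    then show "x \<in> T -` ?b" using K(2)[of x] by simp
  qed
  moreover have "T -` ?b \<in> sets lborel"
    using T(1) by (simp, intro borel_open open_vimage linear_continuous_on)
      (auto simp: linear_conv_bounded_linear)
  ultimately have "measure lborel (ball (0::'a) (1 / K)) \<le> measure lborel (T -` ?b)"
    using fin by (intro measure_mono_fmeasurable) (auto simp: fmeasurable_def)
  moreover have "measure lborel (ball (0::'a) (1 / K)) > 0"
    using K(1) by (simp add: content_ball_pos)
  ultimately have pos: "measure lborel (T -` ?b) > 0" by linarith
  have pos1: "measure lborel ?b > 0" by (simp add: content_ball_pos)
  show "measure lborel ?b / measure lborel (T -` ?b) > 0" using pos pos1 by simp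
  fix B :: "'a set" assume "B \<in> sets borel"
  from emeasure_linear_vimage[OF T this]
  have "measure lborel B * measure lborel (T -` ?b) = measure lborel ?b * measure lborel (T -` B)"
    by (simp add: measure_def enn2real_mult[symmetric])
  with pos show "measure lborel B = measure lborel ?b / measure lborel (T -` ?b) * measure lborel (T -` B)"
    by (simp add: field_simps)
qed

subsection \<open>Cones over spherical sets\<close>

text \<open>For Borel \<open>A\<close> in the sphere, the surface measure is \<open>CARD('n)\<close>
  times the volume of this cone, so density on the sphere becomes density in the ambient
  space.\<close>

definition open_cone :: "(real ^ 'n) set \<Rightarrow> (real ^ 'n) set" where
  "open_cone A = {t *\<^sub>R u | t u. 0 < t \<and> t < 1 \<and> u \<in> A}"

lemma mem_open_cone_iff:
  fixes A :: "(real ^ 'n) set"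
  assumes "A \<subseteq> sphere 0 1"
  shows "x \<in> open_cone A \<longleftrightarrow> x \<noteq> 0 \<and> norm x < 1 \<and> sgn x \<in> A"
proof
  assume "x \<in> open_cone A"
  then obtain t u where x: "x = t *\<^sub>R u" "0 < t" "t < 1" "u \<in> A" by (auto simp: open_cone_def)
  then have "norm u = 1" using assms by auto
  with x have "norm x = t" "sgn x = u" by (auto simp: sgn_div_norm)
  with x show "x \<noteq> 0 \<and> norm x < 1 \<and> sgn x \<in> A" by auto
next
  assume x: "x \<noteq> 0 \<and> norm x < 1 \<and> sgn x \<in> A"
  then have "x = norm x *\<^sub>R sgn x" by (simp add: sgn_div_norm)
  with x show "x \<in> open_cone A" by (auto simp: open_cone_def intro!: exI[of _ "norm x"] exI[of _ "sgn x"])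
qed

lemma borel_open_cone:
  fixes A :: "(real ^ 'n) set"
  assumes A: "A \<in> sets borel" "A \<subseteq> sphere 0 1"
  shows "open_cone A \<in> sets borel"
proof -
  have "(\<lambda>x :: real ^ 'n. x /\<^sub>R norm x) \<in> borel_measurable borel" by measurable
  then have "(sgn :: real ^ 'n \<Rightarrow> _) \<in> borel_measurable borel" by (simp add: sgn_div_norm[abs_def])
  then have "sgn -` A \<in> sets borel" using A(1) by (metis measurable_sets_borel)
  then have "sgn -` A \<inter> (ball 0 1 - {0}) \<in> sets borel" by auto
  also have "sgn -` A \<inter> (ball 0 1 - {0}) = open_cone A"
    by (intro set_eqI) (subst mem_open_cone_iff[OF A(2)], auto)
  finally show ?thesis .
qed

lemma measure_surface_measure:
  fixes A :: "(real ^ 'n) set"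
  assumes "A \<in> sets borel" "A \<subseteq> sphere 0 1"
  shows "measure surface_measure A = CARD('n) * measure lborel (open_cone A)"
  by (simp add: measure_def emeasure_surface_measure(2)[OF assms] open_cone_def enn2real_mult)

text \<open>Sets measurable for the completion need not be Borel, whereas the slicing argument is
  carried out for Borel sets. The main part of \<open>E\<close> differs from \<open>E\<close> by a
  null part only.\<close>

lemma surface_measure_inner_borel:
  assumes "E \<in> sets (surface_measure :: (real ^ 'n) measure)"
  obtains A where "A \<in> sets borel" "A \<subseteq> E" "A \<subseteq> sphere 0 1"
    "measure surface_measure A = measure surface_measure E"
proof -
  let ?M = "scale_measure (of_nat CARD('n))
     (distr (restrict_space lborel (ball 0 1 - {0})) (restrict_space borel (sphere 0 1)) sgn) :: (real ^ 'n) measure"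
  have E: "E \<in> sets (completion ?M)" using assms by (simp add: surface_measure_def)
  let ?A = "main_part ?M E"
  have A: "?A \<in> sets ?M" using E by (rule main_part_sets)
  then have "?A \<in> sets borel" "?A \<subseteq> sphere 0 1"
    by (auto simp: sets_restrict_space_iff)
  moreover have "?A \<subseteq> E" using main_part_null_part_Un[OF E] by blast
  moreover have "emeasure surface_measure ?A = emeasure surface_measure E"
    unfolding surface_measure_def using A E by (simp add: emeasure_completion sets_completionI_sets)
  ultimately show ?thesis using that by (simp add: measure_def)
qed

section \<open>Geodesic balls and the rescaling of their thin cones\<close>

lemma borel_geodesic_ball:
  fixes u :: "real ^ 'n"
  assumes "norm u = 1"
  shows "geodesic_ball u \<delta> \<in> sets borel"
proof -
  have "- 1 \<le> u \<bullet> v \<and> u \<bullet> v \<le> 1" if "norm v = 1" for v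
    using Cauchy_Schwarz_ineq2[of u v] assms that by (auto simp: abs_le_iff)
  then have "continuous_on (sphere 0 1) (\<lambda>v. arccos (u \<bullet> v))"
    by (intro continuous_on_arccos continuous_intros) auto
  then have "(\<lambda>v. arccos (u \<bullet> v)) \<in> borel_measurable (restrict_space borel (sphere 0 1))"
    by (rule borel_measurable_continuous_on_restrict)
  then have "(\<lambda>v. arccos (u \<bullet> v)) -` {..<\<delta>} \<inter> space (restrict_space borel (sphere 0 1)) \<in> sets (restrict_space borel (sphere 0 1))"
    by (rule measurable_sets) simp
  also have "(\<lambda>v. arccos (u \<bullet> v)) -` {..<\<delta>} \<inter> space (restrict_space borel (sphere 0 1)) = geodesic_ball u \<delta>"
    by (auto simp: geodesic_ball_def geodesic_dist_def space_restrict_space)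
  finally show ?thesis by (auto simp: sets_restrict_space_iff)
qed

lemma polar_coordinates:
  fixes u p :: "real ^ 'n"
  assumes u: "norm u = 1" and "p \<noteq> 0"
  defines "\<theta> \<equiv> geodesic_dist u (sgn p)"
  shows "0 \<le> \<theta>" "\<theta> \<le> pi" "p \<bullet> u = norm p * cos \<theta>" "norm (p - (p \<bullet> u) *\<^sub>R u) = norm p * sin \<theta>"
proof -
  have "\<bar>u \<bullet> sgn p\<bar> \<le> 1"
    using Cauchy_Schwarz_ineq2[of u "sgn p"] u \<open>p \<noteq> 0\<close> by (simp add: norm_sgn)
  then have c: "- 1 \<le> u \<bullet> sgn p" "u \<bullet> sgn p \<le> 1" by auto
  then show \<theta>: "0 \<le> \<theta>" "\<theta> \<le> pi"
    by (auto simp: \<theta>_def geodesic_dist_def arccos_lbound arccos_ubound)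
  have "cos \<theta> = u \<bullet> sgn p" using c by (simp add: \<theta>_def geodesic_dist_def)
  then show pu: "p \<bullet> u = norm p * cos \<theta>"
    using \<open>p \<noteq> 0\<close> by (simp add: sgn_div_norm inner_commute)
  have "(norm (p - (p \<bullet> u) *\<^sub>R u))\<^sup>2 = (norm p)\<^sup>2 * (1 - (cos \<theta>)\<^sup>2)"
    unfolding norm_orthogonal_part[OF u] unfolding pu by (simp add: power_mult_distrib algebra_simps)
  also have "\<dots> = (norm p * sin \<theta>)\<^sup>2"
    by (simp add: power_mult_distrib sin_squared_eq)
  finally show "norm (p - (p \<bullet> u) *\<^sub>R u) = norm p * sin \<theta>"
    by (rule power2_eq_imp_eq) (simp_all add: sin_ge_zero[OF \<theta>])
qed

text \<open>On this range the angle stays below \<open>pi / 3\<close>, so the derivative of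
  \<open>sin x - x / 2\<close> is nonnegative.\<close>

lemma half_le_sin:
  fixes x :: real
  assumes "0 \<le> x" "x \<le> 1"
  shows "x / 2 \<le> sin x"
proof -
  have "sin 0 - 0 / 2 \<le> sin x - x / 2"
  proof (rule DERIV_nonneg_imp_nondecreasing[OF assms(1)])
    fix t assume t: "0 \<le> t" "t \<le> x"
    then have "t \<le> pi / 3" using assms pi_gt3 by linarith
    then have "cos (pi / 3) \<le> cos t" using t by (intro cos_monotone_0_pi_le) auto
    then have "0 \<le> cos t - 1 / 2" by (simp add: cos_60)
    then show "\<exists>y. ((\<lambda>t. sin t - t / 2) has_real_derivative y) (at t) \<and> 0 \<le> y"
      by (intro exI[of _ "cos t - 1 / 2"]) (auto intro!: derivative_eq_intros)
  qed
  then show ?thesis by simp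
qed

text \<open>The map fixes the axis \<open>u\<close> and scales its orthogonal complement by
  \<delta>. Preimages under it turn the thin cone over a geodesic ball of radius \<delta> into a set
  of size comparable to 1, uniformly in \<delta>. For large \<delta> the cone is not thin, hence the
  factor \<open>min \<delta> 1\<close> below.\<close>

definition stretch :: "real ^ 'n \<Rightarrow> real \<Rightarrow> real ^ 'n \<Rightarrow> real ^ 'n" where
  "stretch u \<delta> x = (x \<bullet> u) *\<^sub>R u + \<delta> *\<^sub>R (x - (x \<bullet> u) *\<^sub>R u)"

lemma linear_stretch: "linear (stretch u \<delta>)"
  unfolding stretch_def by (intro linearI) (auto simp: inner_add_left algebra_simps)

lemma stretch_inner: "norm u = 1 \<Longrightarrow> stretch u \<delta> x \<bullet> u = x \<bullet> u"
  by (simp add: stretch_def inner_add_left inner_diff_left dot_square_norm)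

lemma stretch_orthogonal_part:
  "norm u = 1 \<Longrightarrow> stretch u \<delta> x - (stretch u \<delta> x \<bullet> u) *\<^sub>R u = \<delta> *\<^sub>R (x - (x \<bullet> u) *\<^sub>R u)"
  by (simp add: stretch_inner) (simp add: stretch_def)

lemma inj_stretch:
  assumes "norm u = 1" "\<delta> \<noteq> 0"
  shows "inj (stretch u \<delta>)"
proof (rule injI)
  fix x y assume xy: "stretch u \<delta> x = stretch u \<delta> y"
  with stretch_inner[OF assms(1), of \<delta>] have "x \<bullet> u = y \<bullet> u" by metis
  with xy assms(2) show "x = y" by (simp add: stretch_def)
qed

text \<open>At angle \<theta> from \<open>u\<close>, the transverse part of a cone point is at most
  \<open>sin \<theta>\<close>, which is bounded both by \<delta> and by 1. Undoing the stretch makes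
  it at most 1, and the axial part is at most 1 as well.\<close>

lemma vimage_stretch_subset_cball:
  fixes u :: "real ^ 'n"
  assumes u: "norm u = 1" and "\<delta> > 0"
  shows "stretch u (min \<delta> 1) -` open_cone (geodesic_ball u \<delta>) \<subseteq> cball 0 2"
proof
  let ?d = "min \<delta> 1"
  fix x assume "x \<in> stretch u ?d -` open_cone (geodesic_ball u \<delta>)"
  then have p: "stretch u ?d x \<noteq> 0" "norm (stretch u ?d x) < 1" "geodesic_dist u (sgn (stretch u ?d x)) < \<delta>"
    using mem_open_cone_iff[of "geodesic_ball u \<delta>" "stretch u ?d x"]
    by (simp_all add: geodesic_ball_def subset_iff)
  let ?p = "stretch u ?d x" and ?\<theta> = "geodesic_dist u (sgn (stretch u ?d x))"
  note P = polar_coordinates[OF u p(1)]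
  have s: "0 \<le> sin ?\<theta>" "sin ?\<theta> \<le> ?d"
    using P(1,2) p(3) sin_x_le_x[OF P(1)] by (auto intro: sin_ge_zero)
  have "?d * norm (x - (x \<bullet> u) *\<^sub>R u) = norm ?p * sin ?\<theta>"
    using P(4) \<open>\<delta> > 0\<close> unfolding stretch_orthogonal_part[OF u] by simp
  also have "\<dots> \<le> 1 * ?d" using s p(2) by (intro mult_mono) auto
  finally have "?d * norm (x - (x \<bullet> u) *\<^sub>R u) \<le> ?d * 1" by linarith
  then have "norm (x - (x \<bullet> u) *\<^sub>R u) \<le> 1"
    by (rule mult_left_le_imp_le) (use \<open>\<delta> > 0\<close> in simp)
  moreover have "\<bar>x \<bullet> u\<bar> \<le> 1"
    using Cauchy_Schwarz_ineq2[of ?p u] u p(2) stretch_inner[OF u, of ?d x] by simp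
  ultimately show "x \<in> cball 0 2"
    using norm_triangle_sub[of x "(x \<bullet> u) *\<^sub>R u"] u by simp
qed

text \<open>The ball sits halfway along the axis: its points have axial part between 3/8 and 5/8 and
  transverse part below 1/8. Stretching keeps the former and shrinks the latter enough for the angle
  to stay below \<delta>.\<close>

lemma ball_subset_vimage_stretch:
  fixes u :: "real ^ 'n"
  assumes u: "norm u = 1" and "\<delta> > 0"
  shows "ball (u /\<^sub>R 2) (1 / 8) \<subseteq> stretch u (min \<delta> 1) -` open_cone (geodesic_ball u \<delta>)"
proof
  let ?d = "min \<delta> 1"
  fix x assume "x \<in> ball (u /\<^sub>R 2) (1 / 8)"
  then have x: "norm (x - u /\<^sub>R 2) < 1 / 8" by (simp add: dist_norm norm_minus_commute)
  let ?p = "stretch u ?d x" and ?\<theta> = "geodesic_dist u (sgn (stretch u ?d x))"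
  have uu: "u \<bullet> u = 1" using u by (simp add: dot_square_norm)
  have xu: "(x - u /\<^sub>R 2) \<bullet> u = x \<bullet> u - 1 / 2"
    using uu by (simp add: inner_diff_left)
  then have "\<bar>x \<bullet> u - 1 / 2\<bar> < 1 / 8"
    using Cauchy_Schwarz_ineq2[of "x - u /\<^sub>R 2" u] u x by simp
  then have a: "3 / 8 < x \<bullet> u" "x \<bullet> u < 5 / 8"
    by linarith+
  have "norm (x - u /\<^sub>R 2 - ((x - u /\<^sub>R 2) \<bullet> u) *\<^sub>R u) \<le> norm (x - u /\<^sub>R 2)"
    by (rule power2_le_imp_le) (simp_all only: norm_orthogonal_part[OF u] norm_ge_zero, simp)
  moreover have "x - u /\<^sub>R 2 - ((x - u /\<^sub>R 2) \<bullet> u) *\<^sub>R u = x - (x \<bullet> u) *\<^sub>R u"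
    unfolding xu by (simp add: scaleR_diff_left)
  ultimately have y: "norm (x - (x \<bullet> u) *\<^sub>R u) < 1 / 8" using x by (metis order_le_less_trans)
  have pu: "?p \<bullet> u = x \<bullet> u" by (rule stretch_inner[OF u])
  have p0: "?p \<noteq> 0" using pu a by auto
  have yp: "norm (?p - (?p \<bullet> u) *\<^sub>R u) < ?d / 8"
    using y \<open>\<delta> > 0\<close> unfolding stretch_orthogonal_part[OF u] by (simp add: mult_less_cancel_left_disj min_def)
  have p1: "norm ?p < 1"
    using norm_triangle_sub[of ?p "(?p \<bullet> u) *\<^sub>R u"] yp pu a u by simp
  have "norm ?p \<ge> 3 / 8"
    using Cauchy_Schwarz_ineq2[of ?p u] u pu a by simp
  note P = polar_coordinates[OF u p0]
  \<comment> \<open>Otherwise the transverse part would be at least \<open>3 / 8 * (?d / 2)\<close>,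
    exceeding \<open>?d / 8\<close>. The positive axial part keeps the angle below
    \<open>pi / 2\<close>, where \<open>sin\<close> is increasing.\<close>
  have "?\<theta> < \<delta>"
  proof (rule ccontr)
    assume "\<not> ?\<theta> < \<delta>"
    then have d: "?d \<le> ?\<theta>" by simp
    have "0 < norm ?p * cos ?\<theta>" using P(3) pu a by simp
    then have "0 < cos ?\<theta>" by (simp add: zero_less_mult_iff)
    then have "?\<theta> < pi / 2" using P(2) cos_monotone_0_pi_le[of "pi / 2" ?\<theta>] by (cases "?\<theta> < pi / 2") auto
    then have "sin ?d \<le> sin ?\<theta>" using d \<open>\<delta> > 0\<close> by (intro sin_monotone_2pi_le) auto
    with half_le_sin[of ?d] \<open>\<delta> > 0\<close> have "?d / 2 \<le> sin ?\<theta>" by simp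
    with \<open>norm ?p \<ge> 3 / 8\<close> \<open>\<delta> > 0\<close> have "3 / 8 * (?d / 2) \<le> norm ?p * sin ?\<theta>" by (intro mult_mono) auto
    moreover have "0 < ?d" using \<open>\<delta> > 0\<close> by simp
    ultimately show False using yp P(4) by linarith
  qed
  with p0 p1 show "x \<in> stretch u ?d -` open_cone (geodesic_ball u \<delta>)"
    unfolding vimage_eq by (subst mem_open_cone_iff) (auto simp: geodesic_ball_def norm_sgn)
qed

text \<open>After undoing the stretch, the cone over a Borel part of \<open>E\<close> fills a fixed
  proportion of a set of fixed size, so some line parallel to \<open>u\<close> meets it in length
  more than \<mu>. The stretched line lies in a plane containing \<open>u\<close>, and radial
  projection sends it to a great circle. Separated points on the line become separated
  angles.\<close>

lemma separated_points_on_great_circle: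
  fixes u :: "real ^ 'n"
  assumes dim: "CARD('n) \<ge> 2" and u: "norm u = 1" and "\<delta> > 0" and E: "E \<in> sets surface_measure"
    and "\<rho> \<ge> 0"
    and dense: "\<rho> * measure surface_measure (geodesic_ball u \<delta>) \<le> measure surface_measure (E \<inter> geodesic_ball u \<delta>)"
    and "\<kappa> > 0" "\<mu> > 0" "\<eta> > 0" and N: "2 * real N * \<eta> \<le> \<mu>"
    and small: "(2 * \<kappa> + \<mu>) * measure lborel (cball (0 :: real ^ 'n) 3) < \<rho> * measure lborel (ball (0 :: real ^ 'n) (1 / 8))"
  obtains v X where "norm v = 1" "u \<bullet> v = 0" "finite X" "card X = N" "X \<subseteq> {0..\<delta>}"
    "\<And>\<theta>. \<theta> \<in> X \<Longrightarrow> cos \<theta> *\<^sub>R u + sin \<theta> *\<^sub>R v \<in> E"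
    "\<And>\<theta> \<theta>'. \<theta> \<in> X \<Longrightarrow> \<theta>' \<in> X \<Longrightarrow> \<theta> \<noteq> \<theta>' \<Longrightarrow> min \<delta> 1 * \<kappa> * \<eta> \<le> \<bar>\<theta> - \<theta>'\<bar>"
proof -
  define d where "d = min \<delta> 1"
  have d: "d > 0" using \<open>\<delta> > 0\<close> by (simp add: d_def)
  let ?B = "geodesic_ball u \<delta>"
  have B: "?B \<in> sets borel" "?B \<subseteq> sphere 0 1"
    using borel_geodesic_ball[OF u] by (auto simp: geodesic_ball_def)
  have "E \<inter> ?B \<in> sets surface_measure"
    using E emeasure_surface_measure(1)[OF B] by blast
  then obtain A where A: "A \<in> sets borel" "A \<subseteq> E \<inter> ?B" "A \<subseteq> sphere 0 1"
    "measure surface_measure A = measure surface_measure (E \<inter> ?B)"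
    by (rule surface_measure_inner_borel)
  define A' where "A' = stretch u d -` open_cone A"
  define B' where "B' = stretch u d -` open_cone ?B"
  have lin: "linear (stretch u d)" by (rule linear_stretch)
  have inj: "inj (stretch u d)" using u d by (intro inj_stretch) auto
  obtain D where D: "D > 0"
    "\<And>C. C \<in> sets borel \<Longrightarrow> measure lborel C = D * measure lborel (stretch u d -` C)"
    using measure_linear_vimage[OF lin inj] by blast
  have "stretch u d \<in> borel_measurable borel"
    using lin by (intro borel_measurable_continuous_onI linear_continuous_on) (simp add: linear_conv_bounded_linear)
  then have A'B': "A' \<in> sets borel" "B' \<in> sets borel"
    unfolding A'_def B'_def using borel_open_cone[OF A(1,3)] borel_open_cone[OF B]
    by (auto intro: measurable_sets_borel)
  have B'2: "B' \<subseteq> cball 0 2"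
    using vimage_stretch_subset_cball[OF u \<open>\<delta> > 0\<close>] by (simp add: B'_def d_def)
  moreover have "A' \<subseteq> B'" using A(2) unfolding A'_def B'_def open_cone_def by blast
  ultimately have A'2: "A' \<subseteq> cball 0 2" by blast
  have fin: "emeasure lborel A' < \<infinity>" "emeasure lborel B' < \<infinity>"
    using emeasure_bounded_finite bounded_subset[OF bounded_cball] A'2 B'2 by blast+
  \<comment> \<open>The density survives the passage from the sphere to the cones and then to their
    preimages, since the factors \<open>CARD('n)\<close> and \<open>D\<close> are common to both
    sides.\<close>
  have "measure lborel (open_cone A) \<ge> \<rho> * measure lborel (open_cone ?B)"
    using dense unfolding A(4)[symmetric] measure_surface_measure[OF A(1,3)] measure_surface_measure[OF B]
    by (simp add: mult.left_commute[of \<rho>])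
  then have "D * measure lborel A' \<ge> D * (\<rho> * measure lborel B')"
    using D(2)[OF borel_open_cone[OF A(1,3)]] D(2)[OF borel_open_cone[OF B]]
    by (simp add: A'_def B'_def mult_ac)
  then have "measure lborel A' \<ge> \<rho> * measure lborel B'" using D(1) by simp
  moreover have "measure lborel B' \<ge> measure lborel (ball (0 :: real ^ 'n) (1 / 8))"
  proof -
    have "measure lborel (ball (u /\<^sub>R 2) (1 / 8)) \<le> measure lborel B'"
      using ball_subset_vimage_stretch[OF u \<open>\<delta> > 0\<close>] A'B' fin
      by (intro measure_mono_fmeasurable) (auto simp: fmeasurable_def B'_def d_def)
    then show ?thesis by (simp add: content_ball)
  qed
  ultimately have "measure lborel A' \<ge> \<rho> * measure lborel (ball (0 :: real ^ 'n) (1 / 8))"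
    using \<open>\<rho> \<ge> 0\<close> by (meson mult_left_mono order_trans)
  with small have "(2 * \<kappa> + \<mu>) * measure lborel (cball (0 :: real ^ 'n) 3) < measure lborel A'" by linarith
  then have "ennreal ((2 * \<kappa> + \<mu>) * measure lborel (cball (0 :: real ^ 'n) 3)) < ennreal (measure lborel A')"
    using \<open>\<kappa> > 0\<close> \<open>\<mu> > 0\<close> by (intro ennreal_lessI) (auto intro: le_less_trans[rotated])
  moreover have "ennreal (measure lborel A') = emeasure lborel A'"
    using fin(1) by (simp add: emeasure_eq_ennreal_measure)
  moreover have "ennreal (measure lborel (cball (0 :: real ^ 'n) 3)) = emeasure lborel (cball (0 :: real ^ 'n) 3)"
    using emeasure_lborel_cball_finite[of "0 :: real ^ 'n" 3] by (simp add: emeasure_eq_ennreal_measure)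
  ultimately have big: "ennreal (2 * \<kappa> + \<mu>) * emeasure lborel (cball (0 :: real ^ 'n) 3) < emeasure lborel A'"
    using \<open>\<kappa> > 0\<close> \<open>\<mu> > 0\<close> by (simp add: ennreal_mult)
  have dim': "DIM(real ^ 'n) \<ge> 2" using dim by simp
  obtain y where y: "y \<bullet> u = 0" "norm y \<ge> \<kappa>" "emeasure lborel {s. y + s *\<^sub>R u \<in> A'} > ennreal \<mu>"
    using exists_large_slice[OF dim' u A'B'(1) A'2 \<open>\<kappa> > 0\<close> \<open>\<mu> > 0\<close> big] by blast
  have "{s. y + s *\<^sub>R u \<in> A'} \<in> sets lborel" using A'B'(1) by measurable
  moreover have "emeasure lborel {s. y + s *\<^sub>R u \<in> A'} > ennreal (2 * real N * \<eta>)"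
    using y(3) ennreal_leI[OF N] by (rule le_less_trans[rotated])
  ultimately obtain Y where Y: "finite Y" "card Y = N" "Y \<subseteq> {s. y + s *\<^sub>R u \<in> A'}"
    "\<And>s t. s \<in> Y \<Longrightarrow> t \<in> Y \<Longrightarrow> s \<noteq> t \<Longrightarrow> \<eta> \<le> \<bar>s - t\<bar>"
    using separated_points[of "{s. y + s *\<^sub>R u \<in> A'}" \<eta> N] \<open>\<eta> > 0\<close> by auto
  define v where "v = sgn y"
  have y0: "y \<noteq> 0" using y(2) \<open>\<kappa> > 0\<close> by auto
  have v: "norm v = 1" "u \<bullet> v = 0"
    using y(1) y0 by (auto simp: v_def norm_sgn sgn_div_norm inner_commute)
  define p where "p s = stretch u d (y + s *\<^sub>R u)" for s
  define \<Theta> where "\<Theta> s = geodesic_dist u (sgn (p s))" for s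
  have uu: "u \<bullet> u = 1" using u by (simp add: dot_square_norm)
  have yu: "(y + s *\<^sub>R u) \<bullet> u = s" for s using y(1) uu by (simp add: inner_add_left)
  have p: "p s = s *\<^sub>R u + d *\<^sub>R y" for s
    unfolding p_def stretch_def yu by simp
  have pu: "p s \<bullet> u = s" for s
    unfolding p using y(1) uu by (simp add: inner_add_left)
  have props: "sgn (p s) \<in> A" "p s \<noteq> 0" "norm (p s) < 1" "0 \<le> \<Theta> s" "\<Theta> s < \<delta>"
    "s = norm (p s) * cos (\<Theta> s)" "d * norm y = norm (p s) * sin (\<Theta> s)" if "s \<in> Y" for s
  proof -
    have "p s \<in> open_cone A" using Y(3) that by (auto simp: A'_def p_def)
    then show *: "sgn (p s) \<in> A" "p s \<noteq> 0" "norm (p s) < 1"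
      unfolding mem_open_cone_iff[OF A(3)] by simp_all
    then show "\<Theta> s < \<delta>" using A(2) by (auto simp: \<Theta>_def geodesic_ball_def)
    note P = polar_coordinates[OF u *(2), folded \<Theta>_def]
    show "0 \<le> \<Theta> s" by (rule P(1))
    show "s = norm (p s) * cos (\<Theta> s)" using P(3) by (simp only: pu)
    have "p s - (p s \<bullet> u) *\<^sub>R u = d *\<^sub>R y" unfolding pu unfolding p by simp
    then show "d * norm y = norm (p s) * sin (\<Theta> s)" using P(4) d by simp
  qed
  \<comment> \<open>Both \<open>p s\<close> and \<open>p t\<close> have component
    \<open>d * norm y\<close> along \<open>v\<close>. Their planar determinant is therefore
    \<open>d * norm y * (s - t)\<close>, and in polar form it is
    \<open>norm (p s) * norm (p t) * sin (\<Theta> t - \<Theta> s)\<close>. As both norms are below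
    1, the angle difference dominates it.\<close>
  have sep: "d * \<kappa> * \<eta> \<le> \<bar>\<Theta> s - \<Theta> t\<bar>" if st: "s \<in> Y" "t \<in> Y" "s \<noteq> t" for s t
  proof -
    have "d * \<kappa> * \<eta> \<le> d * norm y * \<bar>s - t\<bar>"
      using y(2) Y(4)[OF st] d \<open>\<kappa> > 0\<close> \<open>\<eta> > 0\<close> by (intro mult_mono) auto
    also have "\<dots> = \<bar>d * norm y * s - d * norm y * t\<bar>"
      using d by (simp add: abs_mult right_diff_distrib[symmetric])
    also have "d * norm y * s - d * norm y * t = norm (p s) * norm (p t) * sin (\<Theta> t - \<Theta> s)"
    proof -
      have "d * norm y * s - d * norm y * t =
          (norm (p t) * sin (\<Theta> t)) * (norm (p s) * cos (\<Theta> s)) - (norm (p s) * sin (\<Theta> s)) * (norm (p t) * cos (\<Theta> t))"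
        using props(6,7)[OF st(1)] props(6,7)[OF st(2)] by metis
      then show ?thesis by (simp add: sin_diff algebra_simps)
    qed
    also have "\<bar>norm (p s) * norm (p t) * sin (\<Theta> t - \<Theta> s)\<bar> \<le> 1 * \<bar>\<Theta> t - \<Theta> s\<bar>"
      unfolding abs_mult using props(3)[OF st(1)] props(3)[OF st(2)]
      by (intro mult_mono abs_sin_x_le_abs_x) (auto intro: mult_le_one)
    finally show ?thesis by (simp add: abs_minus_commute)
  qed
  have dpos: "d * \<kappa> * \<eta> > 0" using d \<open>\<kappa> > 0\<close> \<open>\<eta> > 0\<close> by simp
  have "inj_on \<Theta> Y"
    by (rule inj_onI) (use sep dpos in fastforce)
  show ?thesis
  proof (rule that[OF v, of "\<Theta> ` Y"])
    show "finite (\<Theta> ` Y)" using Y(1) by simp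
    show "card (\<Theta> ` Y) = N" using Y(2) \<open>inj_on \<Theta> Y\<close> by (simp add: card_image)
    show "\<Theta> ` Y \<subseteq> {0..\<delta>}" using props(4,5) by force
    show "cos \<theta> *\<^sub>R u + sin \<theta> *\<^sub>R v \<in> E" if \<theta>: "\<theta> \<in> \<Theta> ` Y" for \<theta>
    proof -
      obtain s where s: "s \<in> Y" "\<theta> = \<Theta> s" using \<theta> by blast
      have "p s = norm (p s) *\<^sub>R (cos \<theta> *\<^sub>R u + sin \<theta> *\<^sub>R v)"
      proof -
        have "norm (p s) *\<^sub>R (cos \<theta> *\<^sub>R u + sin \<theta> *\<^sub>R v) = s *\<^sub>R u + (d * norm y) *\<^sub>R v"
          using props(6,7)[OF s(1)] s(2) by (simp add: scaleR_add_right)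
        also have "\<dots> = p s" using y0 by (simp add: p v_def sgn_div_norm)
        finally show ?thesis ..
      qed
      then have "inverse (norm (p s)) *\<^sub>R p s = inverse (norm (p s)) *\<^sub>R norm (p s) *\<^sub>R (cos \<theta> *\<^sub>R u + sin \<theta> *\<^sub>R v)"
        by (rule arg_cong)
      then have "cos \<theta> *\<^sub>R u + sin \<theta> *\<^sub>R v = sgn (p s)"
        using props(2)[OF s(1)] by (simp add: sgn_div_norm)
      then show ?thesis using props(1)[OF s(1)] A(2) by auto
    qed
    show "min \<delta> 1 * \<kappa> * \<eta> \<le> \<bar>\<theta> - \<theta>'\<bar>" if "\<theta> \<in> \<Theta> ` Y" "\<theta>' \<in> \<Theta> ` Y" "\<theta> \<noteq> \<theta>'" for \<theta> \<theta>'
      using that sep by (auto simp: d_def)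
  qed
qed

subsection \<open>The inequality on the sphere\<close>

lemma circle_poly_of_real:
  fixes u v :: "real ^ 'n" and c :: "('n \<Rightarrow> nat) \<Rightarrow> complex"
  assumes Q: "\<forall>x\<in>sphere 0 1.
      Q x = (\<Sum>m | (\<Sum>i\<in>UNIV. m i) \<le> L. c m * (\<Prod>i\<in>UNIV. complex_of_real (x $ i) ^ m i))"
    and uv: "norm u = 1" "norm v = 1" "u \<bullet> v = 0"
  shows "cos t *\<^sub>R u + sin t *\<^sub>R v \<in> sphere 0 1"
    and "circle_poly L c u v (complex_of_real t) = Q (cos t *\<^sub>R u + sin t *\<^sub>R v)"
proof -
  have "u \<bullet> u = 1" "v \<bullet> v = 1" using uv by (simp_all add: dot_square_norm)
  then have "(cos t *\<^sub>R u + sin t *\<^sub>R v) \<bullet> (cos t *\<^sub>R u + sin t *\<^sub>R v) = 1"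
    using uv(3) sin_cos_squared_add2[of t]
    by (simp add: inner_add_left inner_add_right inner_commute power2_eq_square)
  then show *: "cos t *\<^sub>R u + sin t *\<^sub>R v \<in> sphere 0 1"
    by (simp add: norm_eq_sqrt_inner)
  show "circle_poly L c u v (complex_of_real t) = Q (cos t *\<^sub>R u + sin t *\<^sub>R v)"
    unfolding circle_poly_def Q[rule_format, OF *] by (simp add: cos_of_real sin_of_real mult.commute)
qed

text \<open>Dividing the angle by \<open>L\<close> turns the growth factor into
  \<open>exp \<bar>Im z\<bar>\<close>, free of \<open>L\<close>. Maximality of
  \<open>cmod (Q u)\<close> bounds the function on the real axis, so
  \<open>interpolation_remez\<close> applies with bound \<open>M * exp (3 * r)\<close> on the circle
  of radius \<open>3 * r\<close>.\<close>

lemma great_circle_bound: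
  fixes u v :: "real ^ 'n" and c :: "('n \<Rightarrow> nat) \<Rightarrow> complex"
  assumes Q: "\<forall>x\<in>sphere 0 1.
      Q x = (\<Sum>m | (\<Sum>i\<in>UNIV. m i) \<le> L. c m * (\<Prod>i\<in>UNIV. complex_of_real (x $ i) ^ m i))"
    and uv: "norm u = 1" "norm v = 1" "u \<bullet> v = 0"
    and max: "\<And>x. x \<in> sphere 0 1 \<Longrightarrow> cmod (Q x) \<le> cmod (Q u)"
    and "L \<ge> 1" "r > 0" "\<eta> > 0" "S \<ge> 0"
    and X: "finite (X :: real set)" "card X = N" "X \<subseteq> {0..r / real L}"
    and sep: "\<And>\<theta> \<theta>'. \<theta> \<in> X \<Longrightarrow> \<theta>' \<in> X \<Longrightarrow> \<theta> \<noteq> \<theta>' \<Longrightarrow> \<eta> \<le> real L * \<bar>\<theta> - \<theta>'\<bar>"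
    and S: "\<And>\<theta>. \<theta> \<in> X \<Longrightarrow> cmod (Q (cos \<theta> *\<^sub>R u + sin \<theta> *\<^sub>R v)) \<le> S"
    and N: "2 * exp (3 * r) \<le> 2 ^ N"
  shows "cmod (Q u) \<le> 4 * real N * (4 * r / \<eta>) ^ (N - 1) * S"
proof -
  define M where "M = cmod (Q u)"
  define f where "f z = circle_poly L c u v (z / of_nat L)" for z
  note circle = circle_poly_of_real[OF Q uv]
  have M: "cmod (circle_poly L c u v (complex_of_real t)) \<le> M" for t
    using max[OF circle(1)] by (simp add: circle(2) M_def)
  define X' where "X' = (\<lambda>\<theta>. complex_of_real (real L * \<theta>)) ` X"
  have L: "real L > 0" using \<open>L \<ge> 1\<close> by simp
  have fX: "f (complex_of_real (real L * \<theta>)) = Q (cos \<theta> *\<^sub>R u + sin \<theta> *\<^sub>R v)" for \<theta>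
    using L by (simp add: f_def circle(2)[symmetric])
  have "cmod (f 0) \<le> M * exp (3 * r) / 2 ^ N + 2 * real N * (4 * r / \<eta>) ^ (N - 1) * S"
  proof (rule interpolation_remez[of f X'])
    show "f holomorphic_on UNIV"
      unfolding f_def using L by (intro holomorphic_intros) auto
    show "finite X'" using X(1) by (simp add: X'_def)
    have "inj_on (\<lambda>\<theta>. complex_of_real (real L * \<theta>)) X"
      using L by (intro inj_onI) (simp only: of_real_eq_iff mult_cancel_left, simp)
    then show "card X' = N" using X(2) by (simp add: X'_def card_image)
    show "X' \<subseteq> cball 0 r"
      using X(3) L by (auto simp: X'_def norm_mult field_simps dest!: subsetD)
    show "\<eta> \<le> cmod (x - y)" if xy: "x \<in> X'" "y \<in> X'" "x \<noteq> y" for x y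
    proof -
      obtain \<theta> \<theta>' :: real where \<theta>: "\<theta> \<in> X" "x = complex_of_real (real L * \<theta>)" "\<theta>' \<in> X" "y = complex_of_real (real L * \<theta>')"
        using xy by (auto simp: X'_def)
      have "x - y = complex_of_real (real L * (\<theta> - \<theta>'))" by (simp add: \<theta> algebra_simps)
      then have "cmod (x - y) = real L * \<bar>\<theta> - \<theta>'\<bar>"
        by (simp only: norm_of_real abs_mult abs_of_nat)
      with sep[of \<theta> \<theta>'] \<theta> xy(3) show ?thesis by auto
    qed
    show "cmod (f x) \<le> S" if "x \<in> X'" for x
      using that S by (auto simp: X'_def fX simp del: of_real_mult)
    show "cmod (f z) \<le> M * exp (3 * r)" if "cmod z = 3 * r" for z
    proof -
      have "cmod (f z) \<le> M * exp (real L * \<bar>Im (z / of_nat L)\<bar>)"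
        unfolding f_def by (rule circle_poly_growth[OF M])
      also have "real L * \<bar>Im (z / of_nat L)\<bar> = \<bar>Im z\<bar>"
        using L by simp
      also have "M * exp \<bar>Im z\<bar> \<le> M * exp (3 * r)"
        using abs_Im_le_cmod[of z] that by (intro mult_left_mono) (auto simp: M_def)
      finally show ?thesis .
    qed
  qed (use assms in auto)
  moreover have "cmod (f 0) = M" using fX[of 0] by (simp add: M_def)
  \<comment> \<open>Half of \<open>M\<close> is absorbed into the left side, which doubles the
    constant from 2 to 4.\<close>
  moreover have "M * exp (3 * r) / 2 ^ N \<le> M / 2"
  proof -
    have "M * (2 * exp (3 * r)) \<le> M * 2 ^ N" using N by (intro mult_left_mono) (auto simp: M_def)
    then show ?thesis by (simp add: field_simps)
  qed
  ultimately have "M \<le> M / 2 + 2 * real N * (4 * r / \<eta>) ^ (N - 1) * S" by linarith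
  then show ?thesis by (simp add: M_def)
qed

theorem theorem3p1:
  fixes d :: nat and E :: "nat \<Rightarrow> (real ^ 'n) set"
  assumes "d \<ge> 1" and "CARD('n) = d + 1"
    and "\<And>L. L \<ge> 1 \<Longrightarrow> E L \<in> sets surface_measure"
    and "relatively_dense E"
  shows "Linfty_Logvinenko_Sereda E"
proof -
  obtain r \<rho> where r\<rho>: "r > 0" "\<rho> > 0" and inf: "\<And>L. L \<ge> 1 \<Longrightarrow>
     (INF u\<in>sphere 0 1. measure surface_measure (E L \<inter> geodesic_ball u (r / real L)) /
        measure surface_measure (geodesic_ball u (r / real L))) \<ge> \<rho>"
    using assms(4) unfolding relatively_dense_def by blast
  let ?\<sigma> = "measure (surface_measure :: (real ^ 'n) measure)"
  have dense: "\<rho> * ?\<sigma> (geodesic_ball u (r / real L)) \<le> ?\<sigma> (E L \<inter> geodesic_ball u (r / real L))"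
    if "L \<ge> 1" "u \<in> sphere 0 1" for L u
  proof -
    let ?q = "\<lambda>u. ?\<sigma> (E L \<inter> geodesic_ball u (r / real L)) / ?\<sigma> (geodesic_ball u (r / real L))"
    \<comment> \<open>A real-valued \<open>INF\<close> bounds its members from below only if the
      family is bounded below; here 0 is such a bound.\<close>
    have "bdd_below (?q ` sphere 0 1)" by (intro bdd_belowI[of _ 0]) auto
    then have "\<rho> \<le> ?q u" using inf[OF that(1)] cINF_lower[of ?q "sphere 0 1" u] that(2) by linarith
    moreover have "?\<sigma> (geodesic_ball u (r / real L)) \<ge> 0" by simp
    ultimately show ?thesis
      using \<open>\<rho> > 0\<close> by (cases "?\<sigma> (geodesic_ball u (r / real L)) = 0") (auto simp: field_simps)
  qed
  define V where "V = measure lborel (cball (0 :: real ^ 'n) 3)"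
  define W where "W = measure lborel (ball (0 :: real ^ 'n) (1 / 8))"
  have VW: "V > 0" "W > 0" by (simp_all add: V_def W_def content_ball_pos content_cball_pos)
  \<comment> \<open>The same number serves as \<kappa> and as \<mu> in the slicing argument; with
    this choice \<open>3 * \<kappa> * V\<close> is three quarters of
    \<open>\<rho> * W\<close>.\<close>
  define \<kappa> where "\<kappa> = \<rho> * W / (4 * V)"
  have \<kappa>: "\<kappa> > 0" "(2 * \<kappa> + \<kappa>) * V < \<rho> * W" using VW r\<rho> by (simp_all add: \<kappa>_def)
  obtain N where N: "2 * exp (3 * r) \<le> 2 ^ N"
    using real_arch_pow[of 2 "2 * exp (3 * r)"] by (auto intro: less_imp_le)
  \<comment> \<open>The summand 1 keeps the denominator positive for every \<open>N\<close>.\<close>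
  define \<eta> where "\<eta> = \<kappa> / (2 * (real N + 1))"
  have \<eta>: "\<eta> > 0" "2 * real N * \<eta> \<le> \<kappa>"
    using \<kappa>(1) by (simp_all add: \<eta>_def field_simps)
  \<comment> \<open>This is a lower bound for the separation after multiplying angles by
    \<open>L\<close>, uniform in \<open>L\<close> because \<open>L * min (r / L) 1\<close> is at
    least \<open>min r 1\<close>.\<close>
  define \<eta>' where "\<eta>' = min r 1 * \<kappa> * \<eta>"
  have \<eta>': "\<eta>' > 0" using \<eta> \<kappa> r\<rho> by (simp add: \<eta>'_def)
  define C where "C = 4 * real N * (4 * r / \<eta>') ^ (N - 1) + 1"
  have C: "C > 0" using \<eta>' r\<rho> by (simp add: C_def add_nonneg_pos)
  have "(SUP u\<in>sphere 0 1. ennreal (cmod (Q u))) \<le> ennreal C * (SUP u\<in>E L. ennreal (cmod (Q u)))"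
    if L: "L \<ge> 1" and "Q \<in> spherical_polys L" for L and Q :: "real ^ 'n \<Rightarrow> complex"
  \<comment> \<open>An infinite supremum makes the right side infinite since \<open>C\<close> is
    positive. Otherwise it is a real number \<open>S\<close>, equal to 0 if \<open>E L\<close> is
    empty.\<close>
  proof (cases "(SUP u\<in>E L. ennreal (cmod (Q u))) = top")
    case True
    then show ?thesis unfolding True using C by (simp add: ennreal_mult_top)
  next
    case False
    define S where "S = enn2real (SUP u\<in>E L. ennreal (cmod (Q u)))"
    have S: "(SUP u\<in>E L. ennreal (cmod (Q u))) = ennreal S" "S \<ge> 0"
      unfolding S_def using False by (simp_all only: ennreal_enn2real_if if_False enn2real_nonneg)
    have QS: "cmod (Q u) \<le> S" if "u \<in> E L" for u
    proof -
      have "ennreal (cmod (Q u)) \<le> ennreal S" unfolding S(1)[symmetric] using that by (rule SUP_upper)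
      then show ?thesis using S(2) by simp
    qed
    obtain c where c: "\<forall>x\<in>sphere 0 1.
      Q x = (\<Sum>m | (\<Sum>i\<in>UNIV. m i) \<le> L. c m * (\<Prod>i\<in>UNIV. complex_of_real (x $ i) ^ m i))"
      using \<open>Q \<in> spherical_polys L\<close> unfolding spherical_polys_def by blast
    \<comment> \<open>\<open>Q\<close> is arbitrary off the sphere, so continuity is transferred
      from the polynomial on the sphere only. Compactness then gives a maximum point
      \<open>u\<close>.\<close>
    have "continuous_on (sphere 0 1) Q \<longleftrightarrow> continuous_on (sphere 0 1) (\<lambda>x :: real ^ 'n.
      \<Sum>m | (\<Sum>i\<in>UNIV. m i) \<le> L. c m * (\<Prod>i\<in>UNIV. complex_of_real (x $ i) ^ m i))"
      by (intro continuous_on_cong refl) (use c in blast)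
    also have "\<dots>" by (intro continuous_intros)
    finally have "continuous_on (sphere 0 1) (\<lambda>x. cmod (Q x))" by (intro continuous_intros)
    moreover have "sphere (0 :: real ^ 'n) 1 \<noteq> {}" by simp
    ultimately obtain u where u: "u \<in> sphere 0 1" "\<And>x. x \<in> sphere 0 1 \<Longrightarrow> cmod (Q x) \<le> cmod (Q u)"
      using continuous_attains_sup[OF compact_sphere] by blast
    have nu: "norm u = 1" using u(1) by simp
    have dim: "CARD('n) \<ge> 2" using assms(1,2) by simp
    have \<delta>: "r / real L > 0" using r\<rho> L by simp
    obtain v X where vX: "norm v = 1" "u \<bullet> v = 0" "finite X" "card X = N" "X \<subseteq> {0..r / real L}"
      "\<And>\<theta>. \<theta> \<in> X \<Longrightarrow> cos \<theta> *\<^sub>R u + sin \<theta> *\<^sub>R v \<in> E L"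
      "\<And>\<theta> \<theta>'. \<theta> \<in> X \<Longrightarrow> \<theta>' \<in> X \<Longrightarrow> \<theta> \<noteq> \<theta>' \<Longrightarrow> min (r / real L) 1 * \<kappa> * \<eta> \<le> \<bar>\<theta> - \<theta>'\<bar>"
      using separated_points_on_great_circle[OF dim nu \<delta> assms(3)[OF L] less_imp_le[OF r\<rho>(2)]
        dense[OF L u(1)] \<kappa>(1) \<kappa>(1) \<eta> \<kappa>(2)[unfolded V_def W_def]] by blast
    have sep: "\<eta>' \<le> real L * \<bar>\<theta> - \<theta>'\<bar>" if "\<theta> \<in> X" "\<theta>' \<in> X" "\<theta> \<noteq> \<theta>'" for \<theta> \<theta>' :: real
    proof -
      have "min r 1 \<le> L * min (r / real L) 1"
        using L r\<rho> by (auto simp: min_def field_simps)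
      then have "\<eta>' \<le> L * min (r / real L) 1 * \<kappa> * \<eta>"
        unfolding \<eta>'_def using \<kappa> \<eta> by (intro mult_right_mono) auto
      also have "\<dots> \<le> real L * \<bar>\<theta> - \<theta>'\<bar>"
        using vX(7)[OF that] by (simp add: mult.assoc mult_left_mono)
      finally show ?thesis .
    qed
    have "cmod (Q u) \<le> 4 * real N * (4 * r / \<eta>') ^ (N - 1) * S"
      by (rule great_circle_bound[OF c nu vX(1,2) _ L r\<rho>(1) \<eta>' S(2) vX(3-5) _ _ N])
        (use u(2) sep QS vX(6) in blast)+
    also have "\<dots> \<le> C * S" using S(2) by (simp add: C_def distrib_right)
    finally have "cmod (Q u) \<le> C * S" .
    then have "ennreal (cmod (Q x)) \<le> ennreal (C * S)" if "x \<in> sphere 0 1" for x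
      using u(2)[OF that] by (intro ennreal_leI) linarith
    then show ?thesis
      unfolding S(1) using C S(2) by (intro SUP_least) (auto simp: ennreal_mult)
  qed
  then show ?thesis unfolding Linfty_Logvinenko_Sereda_def using C by blast
qed

end
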